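(* Let $p$ be a prime, let $q$ be a power of $p$, and let $H$ be a subgroup of $D(2,q)$ of cube-free order $m$, where $p\nmid m$. Let $m=p_0^{\beta_0}p_1^{\beta_1}\cdots p_k^{\beta_k}$ be the prime decomposition of $m$, where $p_0=2$, the primes $p_0,\dots,p_k$ are distinct, the $\beta_i$ are integers with $\beta_i\ge 0$ for all $i$, and at least one $\beta_i>0$. If $\beta_i>0$, let $P_i$ denote a Sylow $p_i$-subgroup of $H$. Let $\mathcal{I}=\{i>0 \mid \beta_i>0 \text{ and } P_i \text{ is cyclic}\}$ and let $r=|\mathcal{I}|$. Let $N_{red}(m,H)$ be the number of conjugacy classes of reducible subgroups of $\mathrm{GL}(2,q)$ of order $m$ that are isomorphic to $H$. Then $$N_{red}(m,H)=\frac12\bigl(\rho(m,H)+\delta(m,H)\bigr),$$ where $$\rho(m,H)=\begin{cases}\displaystyle\prod_{i\in\mathcal{I}\cup\{0\}}\bigl(p_i^{\beta_i}+p_i^{\beta_i-1}\bigr) & \text{if } r\ge 0,\ m\ge 2 \text{ is even and } P_0 \text{ is cyclic},\\[2mm] \displaystyle\prod_{i\in\mathcal{I}}\bigl(p_i^{\beta_i}+p_i^{\beta_i-1}\bigr) & \text{if } r>0 \text{ and } (m>2 \text{ is odd or } P_0\cong\mathbb{Z}_2\times\mathbb{Z}_2),\\[2mm] 1 & \text{if } r=0 \text{ and } (\beta_0=0 \text{ or } P_0\cong\mathbb{Z}_2\times\mathbb{Z}_2),\end{cases}$$ and $$\delta(m,H)=\begin{cases}2^r & \text{if } r\ge 0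 \text{ and } (0\le\beta_0\le 1 \text{ or } P_0\cong\mathbb{Z}_2\times\mathbb{Z}_2),\\ 2^{r+1} & \text{if } r\ge 0,\ \beta_0=2 \text{ and } P_0\cong\mathbb{Z}_4.\end{cases}$$
   Context: $\mathbb{F}_q$ is the finite field of order $q$. $D(2,q)$ denotes the subgroup of all diagonal matrices in $\mathrm{GL}(2,q)=\mathrm{GL}(2,\mathbb{F}_q)$. A positive integer is cube-free if it is not divisible by the cube of any prime. A subgroup of $\mathrm{GL}(2,q)$ is reducible if it leaves invariant some one-dimensional subspace of $\mathbb{F}_q^2$. Conjugacy classes of subgroups are taken with respect to conjugation in $\mathrm{GL}(2,q)$. $\mathbb{Z}_n$ denotes the cyclic group of order $n$. *)

theory Defs
  imports
    "HOL-Analysis.Analysis"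
    "HOL-Computational_Algebra.Primes"
    "HOL-Algebra.Elementary_Groups"
begin

definition cube_free :: "nat \<Rightarrow> bool" where
  "cube_free m \<longleftrightarrow> m > 0 \<and> (\<forall>l. prime l \<longrightarrow> \<not> l ^ 3 dvd m)"

definition GL2 :: "('a::field ^ 2 ^ 2) monoid" where
  "GL2 = \<lparr>carrier = {A. invertible A}, mult = (**), one = mat 1\<rparr>"

definition D2 :: "('a::field ^ 2 ^ 2) set" where
  "D2 = {A \<in> carrier GL2. \<forall>i j. i \<noteq> j \<longrightarrow> A $ i $ j = 0}"

definition reducible_subgroup :: "('a::field ^ 2 ^ 2) set \<Rightarrow> bool" where
  "reducible_subgroup K \<longleftrightarrow>
     subgroup K GL2 \<and>
     (\<exists>W :: ('a ^ 2) set. vec.subspace W \<and> vec.dim W = 1 \<and> (\<forall>A\<in>K. (*v) A ` W \<subseteq> W))"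

definition subgroup_conj_class :: "('g, 'x) monoid_scheme \<Rightarrow> 'g set \<Rightarrow> 'g set set" where
  "subgroup_conj_class G K = {g <#\<^bsub>G\<^esub> K #>\<^bsub>G\<^esub> inv\<^bsub>G\<^esub> g | g. g \<in> carrier G}"

definition sylow_subgroup :: "nat \<Rightarrow> ('g, 'x) monoid_scheme \<Rightarrow> 'g set \<Rightarrow> bool" where
  "sylow_subgroup l G P \<longleftrightarrow> subgroup P G \<and> card P = l ^ multiplicity l (card (carrier G))"

definition N_red :: "nat \<Rightarrow> ('a::field ^ 2 ^ 2) set \<Rightarrow> nat" where
  "N_red m H = card (subgroup_conj_class GL2 `
     {K :: ('a ^ 2 ^ 2) set. reducible_subgroup K \<and> card K = m \<and> GL2\<lparr>carrier := K\<rparr> \<cong> GL2\<lparr>carrier := H\<rparr>})"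

abbreviation klein_four :: "(int \<times> int) monoid" where
  "klein_four \<equiv> integer_mod_group 2 \<times>\<times> integer_mod_group 2"

(* In rho and delta, pr i and \<beta> i are the primes and exponents of m, and P0 is the Sylow
   2-subgroup as a group. When \<beta> 0 = 0 no Sylow 2-subgroup is chosen, and the values do not
   depend on P0. Under the hypotheses of the theorem the listed cases are exhaustive and mutually
   exclusive, so undefined is never reached; the truncated subtraction \<beta> i - 1 is only used
   with \<beta> i > 0. *)
definition rho :: "nat \<Rightarrow> (nat \<Rightarrow> nat) \<Rightarrow> (nat \<Rightarrow> nat) \<Rightarrow> nat set \<Rightarrow> nat \<Rightarrow> 'g monoid \<Rightarrow> nat" where
  "rho m pr \<beta> I r P0 =
    (if m \<ge> 2 \<and> even m \<and> cyclic_group P0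
       then \<Prod>i\<in>I \<union> {0}. pr i ^ \<beta> i + pr i ^ (\<beta> i - 1)
     else if r > 0 \<and> (m > 2 \<and> odd m \<or> P0 \<cong> klein_four)
       then \<Prod>i\<in>I. pr i ^ \<beta> i + pr i ^ (\<beta> i - 1)
     else if r = 0 \<and> (\<beta> 0 = 0 \<or> P0 \<cong> klein_four)
       then 1
     else undefined)"

definition delta :: "(nat \<Rightarrow> nat) \<Rightarrow> nat \<Rightarrow> 'g monoid \<Rightarrow> nat" where
  "delta \<beta> r P0 =
    (if \<beta> 0 \<le> 1 \<or> P0 \<cong> klein_four then 2 ^ r
     else if \<beta> 0 = 2 \<and> P0 \<cong> integer_mod_group 4 then 2 ^ (r + 1)
     else undefined)"

end

theory Submission
  imports
    Defs
    "HOL-Algebra.Sylow"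
    "HOL-Algebra.Multiplicative_Group"
    "HOL-Number_Theory.Residues"
begin

text \<open>
  Only diagonal subgroups matter. A reducible subgroup isomorphic to \<open>H\<close> is abelian, has a common
  eigenvector, and has order prime to the characteristic; hence it can be diagonalized
  (\<open>reducible_abelian_conj_diagonal\<close>). Two subgroups of \<open>D2\<close> are conjugate in \<open>GL2\<close> if and only if
  they are equal or arise from each other by interchanging the two diagonal entries
  (\<open>D2_conjugate_cases\<close>). So the conjugacy classes are the orbits of an involution on the set of
  subgroups of \<open>D2\<close> isomorphic to \<open>H\<close>, and their number is half the sum of the size of this set and
  the number of its fixed points (\<open>N_red_eq_swap_orbits\<close>). These two numbers are \<open>rho\<close> and \<open>delta\<close>.

  Both numbers are products over the primes dividing the order of \<open>H\<close>: in a finite abelian group, a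
  subgroup of order \<open>a * b\<close> with \<open>a\<close> and \<open>b\<close> coprime is the direct product of its \<open>a\<close>-torsion and its
  \<open>b\<close>-torsion, and this decomposition is compatible with isomorphisms and with automorphisms of the
  ambient group (\<open>card_fixed_iso_subgroups_prod\<close>). This reduces the count to a Sylow subgroup, of
  order \<open>l ^ \<beta>\<close> with \<open>\<beta> \<le> 2\<close>.

  If it is not cyclic, it must be the whole \<open>l\<close>-torsion of \<open>D2\<close>; it is then unique and invariant, and
  contributes the factor 1 to both products. If it is cyclic, then \<open>l ^ \<beta>\<close> divides \<open>q - 1\<close>, so \<open>D2\<close>
  has as many elements of order \<open>l ^ \<beta>\<close> as the square of a cyclic group of that order, and counting
  generators yields \<open>l ^ \<beta> + l ^ (\<beta> - 1)\<close> subgroups (\<open>card_fixed_iso_subgroups_cyclic\<close>). The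
  invariant ones among them correspond to the square roots of 1 modulo \<open>l ^ \<beta>\<close>. These are \<open>1\<close> and
  \<open>-1\<close>, so there are two of them except for \<open>l ^ \<beta> = 2\<close>, where there is one
  (\<open>card_swap_fixed_cyclic\<close>).
\<close>

section \<open>Torsion parts of finite abelian groups\<close>

definition torsion :: "('g, 'x) monoid_scheme \<Rightarrow> nat \<Rightarrow> 'g set \<Rightarrow> 'g set" where
  "torsion G n K = {x \<in> K. x [^]\<^bsub>G\<^esub> n = \<one>\<^bsub>G\<^esub>}"

text \<open>With \<open>\<sigma> = id\<close> these are all subgroups isomorphic to \<open>H\<close>; with \<open>\<sigma>\<close> the interchange of the
two diagonal entries they are the fixed points in the orbit count. Carrying \<open>\<sigma>\<close> along lets one
argument factor both counts over the primes.\<close>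
definition fixed_iso_subgroups ::
  "('g, 'x) monoid_scheme \<Rightarrow> ('g \<Rightarrow> 'g) \<Rightarrow> 'g set \<Rightarrow> 'g set set" where
  "fixed_iso_subgroups G \<sigma> H =
     {K. subgroup K G \<and> G\<lparr>carrier := K\<rparr> \<cong> G\<lparr>carrier := H\<rparr> \<and> \<sigma> ` K = K}"

lemma (in group) pow_card_subgroup:
  assumes "subgroup K G" "x \<in> K"
  shows "x [^] card K = \<one>"
proof -
  interpret K: group "G\<lparr>carrier := K\<rparr>"
    using subgroup_imp_group[OF assms(1)] .
  show ?thesis
    using K.pow_order_eq_1[of x] assms(2)
    by (simp add: order_def nat_pow_consistent[symmetric])
qed

text \<open>Cauchy's theorem: Sylow's existence theorem holds for every prime power dividing the order, in
particular for \<open>l\<close> itself.\<close>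
lemma (in group) exists_prime_torsion:
  assumes K: "subgroup K G" and fin: "finite K" and l: "prime l" "l dvd card K"
  shows "\<exists>x\<in>K. x \<noteq> \<one> \<and> x [^] l = \<one>"
proof -
  obtain m where m: "card K = l ^ 1 * m"
    using l(2) by auto
  obtain L where L: "subgroup L (G\<lparr>carrier := K\<rparr>)" "card L = l ^ 1"
    using sylow_thm[OF l(1) subgroup_imp_group[OF K], of 1 m] m fin by (auto simp: order_def)
  have LG: "subgroup L G"
    using incl_subgroup[OF K L(1)] .
  have LK: "L \<subseteq> K"
    using subgroup.subset[OF L(1)] by simp
  have "\<not> L \<subseteq> {\<one>}"
  proof
    assume "L \<subseteq> {\<one>}"
    then have "card L \<le> 1"
      using card_mono[of "{\<one>}" L] by simp
    then show False
      using L(2) prime_gt_1_nat[OF l(1)] by simp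
  qed
  then obtain x where x: "x \<in> L" "x \<noteq> \<one>" by auto
  then show ?thesis
    using pow_card_subgroup[OF LG x(1)] L(2) LK by auto
qed

context comm_group begin

lemma subgroup_torsion:
  assumes "subgroup K G"
  shows "subgroup (torsion G n K) G"
proof
  show "torsion G n K \<subseteq> carrier G"
    using subgroup.subset[OF assms] by (auto simp: torsion_def)
  show "\<one> \<in> torsion G n K"
    using subgroup.one_closed[OF assms] by (simp add: torsion_def)
  show "x \<otimes> y \<in> torsion G n K" if "x \<in> torsion G n K" "y \<in> torsion G n K" for x y
    using that subgroup.m_closed[OF assms] subgroup.mem_carrier[OF assms]
    by (auto simp: torsion_def nat_pow_distrib)
  show "inv x \<in> torsion G n K" if "x \<in> torsion G n K" for x
    using that subgroup.m_inv_closed[OF assms] subgroup.mem_carrier[OF assms]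
    by (auto simp: torsion_def nat_pow_inv)
qed

lemma coprime_pow_imp_one:
  assumes "x \<in> carrier G" "x [^] (a::nat) = \<one>" "x [^] (b::nat) = \<one>" "coprime a b"
  shows "x = \<one>"
  using assms by (metis coprime_common_divisor_nat ord_eq_1 pow_eq_id)

lemma torsion_Int_torsion:
  assumes "subgroup K G" "coprime a b"
  shows "torsion G a K \<inter> torsion G b L \<subseteq> {\<one>}"
  using coprime_pow_imp_one[OF subgroup.mem_carrier[OF assms(1)] _ _ assms(2)]
  by (auto simp: torsion_def)

lemma subgroup_Int_coprime:
  assumes "subgroup A G" "subgroup B G" "coprime (card A) (card B)"
  shows "A \<inter> B \<subseteq> {\<one>}"
  using coprime_pow_imp_one[OF subgroup.mem_carrier[OF assms(1)] _ _ assms(3)]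
    pow_card_subgroup[OF assms(1)] pow_card_subgroup[OF assms(2)] by blast

lemma mult_iso_set_mult:
  assumes A: "subgroup A G" and B: "subgroup B G" and AB: "A \<inter> B \<subseteq> {\<one>}"
  shows "(\<lambda>(x, y). x \<otimes> y) \<in> iso (G\<lparr>carrier := A\<rparr> \<times>\<times> G\<lparr>carrier := B\<rparr>) (G\<lparr>carrier := A <#> B\<rparr>)"
proof -
  interpret group_disjoint_sum G A B
    using A B by (simp add: group_disjoint_sum_def group_axioms)
  have c: "x \<in> carrier G" if "x \<in> A \<or> x \<in> B" for x
    using that subgroup.mem_carrier[OF A] subgroup.mem_carrier[OF B] by blast
  have "x = x' \<and> y = y'" if "x \<in> A" "y \<in> B" "x' \<in> A" "y' \<in> B" "x \<otimes> y = x' \<otimes> y'" for x y x' y'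
    using cancel AB that by blast
  then have "inj_on (\<lambda>(x, y). x \<otimes> y) (A \<times> B)"
    by (auto simp: inj_on_def)
  moreover have "(\<lambda>(x, y). x \<otimes> y) ` (A \<times> B) = A <#> B"
    by (auto simp: set_mult_def)
  moreover have "(x \<otimes> x') \<otimes> (y \<otimes> y') = (x \<otimes> y) \<otimes> (x' \<otimes> y')"
    if "x \<in> A" "x' \<in> A" "y \<in> B" "y' \<in> B" for x x' y y'
    using that by (simp add: c m_ac)
  ultimately show ?thesis
    by (auto simp: iso_def hom_def bij_betw_def set_mult_def)
qed

lemma card_set_mult:
  assumes "subgroup A G" "subgroup B G" "A \<inter> B \<subseteq> {\<one>}"
  shows "card (A <#> B) = card A * card B"
  using bij_betw_same_card mult_iso_set_mult[OF assms] by (fastforce simp: iso_def card_cartesian_product)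

lemma set_mult_iso_cong:
  assumes "subgroup A G" "subgroup B G" "A \<inter> B \<subseteq> {\<one>}"
    and "subgroup A' G" "subgroup B' G" "A' \<inter> B' \<subseteq> {\<one>}"
    and "G\<lparr>carrier := A\<rparr> \<cong> G\<lparr>carrier := A'\<rparr>" "G\<lparr>carrier := B\<rparr> \<cong> G\<lparr>carrier := B'\<rparr>"
  shows "G\<lparr>carrier := A <#> B\<rparr> \<cong> G\<lparr>carrier := A' <#> B'\<rparr>"
proof -
  interpret A: group "G\<lparr>carrier := A\<rparr>" using subgroup_imp_group[OF assms(1)] .
  interpret B: group "G\<lparr>carrier := B\<rparr>" using subgroup_imp_group[OF assms(2)] .
  have 1: "G\<lparr>carrier := A\<rparr> \<times>\<times> G\<lparr>carrier := B\<rparr> \<cong> G\<lparr>carrier := A <#> B\<rparr>"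
    using mult_iso_set_mult[OF assms(1-3)] by (rule is_isoI)
  have 2: "G\<lparr>carrier := A'\<rparr> \<times>\<times> G\<lparr>carrier := B'\<rparr> \<cong> G\<lparr>carrier := A' <#> B'\<rparr>"
    using mult_iso_set_mult[OF assms(4-6)] by (rule is_isoI)
  have 3: "G\<lparr>carrier := A\<rparr> \<times>\<times> G\<lparr>carrier := B\<rparr> \<cong> G\<lparr>carrier := A'\<rparr> \<times>\<times> G\<lparr>carrier := B'\<rparr>"
    using A.DirProd_iso_trans assms(7,8) by blast
  show ?thesis
    by (rule iso_trans[OF group.iso_sym[OF DirProd_group[OF A.is_group B.is_group] 1]
          iso_trans[OF 3 2]])
qed

text \<open>Bezout: if \<open>u * a + v * b = 1\<close>, then \<open>x\<close> is the product of its powers with exponents \<open>v * b\<close> and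
\<open>u * a\<close>, which are killed by \<open>a\<close> and by \<open>b\<close> respectively.\<close>
lemma torsion_set_mult_torsion:
  assumes K: "subgroup K G" and card: "card K = a * b" and cop: "coprime a b"
  shows "torsion G a K <#> torsion G b K = K"
proof
  show "torsion G a K <#> torsion G b K \<subseteq> K"
    using subgroup.m_closed[OF K] by (auto simp: set_mult_def torsion_def)
  show "K \<subseteq> torsion G a K <#> torsion G b K"
  proof
    fix x assume x: "x \<in> K"
    then have xc: "x \<in> carrier G" using subgroup.mem_carrier[OF K] by blast
    obtain u v :: int where uv: "u * int a + v * int b = 1"
      using bezout_int[of "int a" "int b"] cop by auto
    have xab: "x [^] (int a * int b) = \<one>"
      using pow_card_subgroup[OF K x] card by (metis int_pow_int of_nat_mult)
    have kill: "(x [^] (w * int c)) [^] d = \<one>" if "int c * int d = int a * int b" for w c d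
    proof -
      have "(x [^] (w * int c)) [^] d = x [^] (w * int c * int d)"
        using xc by (metis int_pow_int int_pow_pow)
      also have "w * int c * int d = (int a * int b) * w"
        using that by (metis mult.assoc mult.commute)
      also have "x [^] \<dots> = \<one>"
        using xc xab by (metis int_pow_one int_pow_pow)
      finally show ?thesis .
    qed
    have K': "x [^] (i::int) \<in> K" for i
      using subgroup_int_pow_closed[OF K x] .
    have "x [^] (v * int b) \<in> torsion G a K" "x [^] (u * int a) \<in> torsion G b K"
      using kill[of b a v] kill[of a b u] K' by (auto simp: torsion_def mult.commute)
    moreover have "x = x [^] (v * int b) \<otimes> x [^] (u * int a)"
      using xc uv by (metis add.commute int_pow_1 int_pow_mult)
    ultimately show "x \<in> torsion G a K <#> torsion G b K"
      unfolding set_mult_def by blast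
  qed
qed

text \<open>By Cauchy's theorem a prime dividing the order of the \<open>a\<close>-torsion divides \<open>a\<close>, so this order is
coprime to \<open>b\<close>; likewise with \<open>a\<close> and \<open>b\<close> exchanged. The two orders multiply to \<open>a * b\<close>, hence
each divides, and then equals, its own factor.\<close>
lemma card_torsion:
  assumes K: "subgroup K G" and fin: "finite K" and card: "card K = a * b" and cop: "coprime a b"
  shows "card (torsion G a K) = a"
proof -
  have sub: "subgroup (torsion G n K) G" for n using subgroup_torsion[OF K] .
  have fint: "finite (torsion G n K)" for n using fin by (simp add: torsion_def)
  have prod: "card (torsion G a K) * card (torsion G b K) = a * b"
    using card_set_mult[OF sub sub torsion_Int_torsion[OF K cop]]
      torsion_set_mult_torsion[OF K card cop] card by simp
  have c: "coprime (card (torsion G c K)) d" if "coprime c d" for c d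
  proof (rule ccontr)
    assume "\<not> coprime (card (torsion G c K)) d"
    then have "gcd (card (torsion G c K)) d \<noteq> 1"
      by (simp add: coprime_iff_gcd_eq_1)
    then obtain l where l: "prime l" "l dvd card (torsion G c K)" "l dvd d"
      using prime_factor_nat gcd_greatest_iff by metis
    obtain x where x: "x \<in> torsion G c K" "x \<noteq> \<one>" "x [^] l = \<one>"
      using exists_prime_torsion[OF sub fint l(1,2)] by blast
    have "coprime c l" using that l(3) by (metis coprime_commute coprime_divisors dvd_refl)
    then show False
      using coprime_pow_imp_one[of x c l] x subgroup.mem_carrier[OF sub x(1)] by (simp add: torsion_def)
  qed
  have pos: "a * b > 0"
    using card fin subgroup.one_closed[OF K] by (metis card_gt_0_iff empty_iff)
  have "card (torsion G a K) dvd a * b" "card (torsion G b K) dvd b * a"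
    using prod by (metis dvd_triv_left dvd_triv_right mult.commute)+
  then have d: "card (torsion G a K) dvd a" "card (torsion G b K) dvd b"
    using c cop by (metis coprime_commute coprime_dvd_mult_left_iff)+
  then show ?thesis
    using prod pos d
    by (metis dvd_imp_le le_antisym mult_le_mono2 mult_less_mono1 nat_0_less_mult_iff not_le order.strict_iff_order)
qed

end

text \<open>Isomorphisms preserve torsion. This makes the splitting into torsion parts compatible both with
isomorphism types and with a given automorphism.\<close>
lemma (in group) iso_imp_image_torsion:
  assumes K: "subgroup K G" and H: "subgroup H G"
    and f: "f \<in> iso (G\<lparr>carrier := K\<rparr>) (G\<lparr>carrier := H\<rparr>)"
  shows "f ` torsion G n K = torsion G n H"
proof -
  interpret f: group_hom "G\<lparr>carrier := K\<rparr>" "G\<lparr>carrier := H\<rparr>" f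
    using f subgroup_imp_group[OF K] subgroup_imp_group[OF H]
    by (simp add: group_hom_def group_hom_axioms_def iso_def)
  have b: "bij_betw f K H" using f by (simp add: iso_def)
  have "f (x [^] n) = f x [^] n" if "x \<in> K" for x
    using f.hom_nat_pow[of x n] that by (simp add: nat_pow_consistent[symmetric])
  moreover have "f \<one> = \<one>" using f.hom_one by simp
  moreover have "x [^] n \<in> K" if "x \<in> K" for x
    using that K by (metis int_pow_int subgroup_int_pow_closed)
  ultimately have "x [^] n = \<one> \<longleftrightarrow> f x [^] n = \<one>" if "x \<in> K" for x
    using that b subgroup.one_closed[OF K] unfolding bij_betw_def inj_on_def by metis
  then show ?thesis
    using b by (auto simp: torsion_def bij_betw_def)
qed

lemma (in group) iso_torsion:
  assumes K: "subgroup K G" and H: "subgroup H G"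
    and iso: "G\<lparr>carrier := K\<rparr> \<cong> G\<lparr>carrier := H\<rparr>"
  shows "G\<lparr>carrier := torsion G n K\<rparr> \<cong> G\<lparr>carrier := torsion G n H\<rparr>"
proof -
  obtain f where f: "f \<in> iso (G\<lparr>carrier := K\<rparr>) (G\<lparr>carrier := H\<rparr>)"
    using iso by (auto simp: is_iso_def)
  have "f \<in> iso (G\<lparr>carrier := torsion G n K\<rparr>) (G\<lparr>carrier := torsion G n H\<rparr>)"
    using f iso_imp_image_torsion[OF K H f, of n]
    by (auto simp: iso_def hom_def bij_betw_def torsion_def inj_on_def)
  then show ?thesis by (rule is_isoI)
qed

section \<open>Isomorphic subgroups and coprime factorizations\<close>

context comm_group begin

text \<open>If a product \<open>x \<otimes> y\<close> is killed by the order of \<open>A\<close>, then so is \<open>y\<close>, which is also killed by the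
coprime order of \<open>B\<close>. So the factor \<open>A\<close> can be recovered from the product.\<close>
lemma torsion_set_mult:
  assumes A: "subgroup A G" and B: "subgroup B G" and cop: "coprime (card A) (card B)"
  shows "torsion G (card A) (A <#> B) = A"
proof
  show "A \<subseteq> torsion G (card A) (A <#> B)"
  proof
    fix x assume x: "x \<in> A"
    have "x = x \<otimes> \<one>" using subgroup.mem_carrier[OF A x] by simp
    then have "x \<in> A <#> B"
      using x subgroup.one_closed[OF B] unfolding set_mult_def by blast
    then show "x \<in> torsion G (card A) (A <#> B)"
      using pow_card_subgroup[OF A x] by (simp add: torsion_def)
  qed
  show "torsion G (card A) (A <#> B) \<subseteq> A"
  proof
    fix z assume z: "z \<in> torsion G (card A) (A <#> B)"
    then obtain x y where xy: "x \<in> A" "y \<in> B" "z = x \<otimes> y"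
      by (auto simp: torsion_def set_mult_def)
    have c: "x \<in> carrier G" "y \<in> carrier G"
      using xy subgroup.mem_carrier[OF A] subgroup.mem_carrier[OF B] by auto
    have "y [^] card A = \<one>"
      using z xy c pow_card_subgroup[OF A xy(1)] by (simp add: torsion_def nat_pow_distrib)
    then have "y = \<one>"
      using coprime_pow_imp_one[OF c(2) _ pow_card_subgroup[OF B xy(2)] cop] by blast
    then show "z \<in> A" using xy c by simp
  qed
qed

lemma subgroup_finite:
  assumes "finite (carrier G)" "subgroup K G"
  shows "finite K"
  using assms finite_subset subgroup.subset by blast

text \<open>The inverse map sends \<open>K\<close> to its \<open>a\<close>- and \<open>b\<close>-torsion. Both directions respect isomorphism
types, because a product of subgroups of coprime order is direct, and both commute with \<open>\<sigma>\<close>.\<close>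
lemma bij_betw_fixed_iso_subgroups:
  assumes fin: "finite (carrier G)" and aut: "\<sigma> \<in> iso G G" and H: "subgroup H G"
    and card: "card H = a * b" and cop: "coprime a b"
  shows "bij_betw (\<lambda>(X, Y). X <#> Y)
    (fixed_iso_subgroups G \<sigma> (torsion G a H) \<times> fixed_iso_subgroups G \<sigma> (torsion G b H))
    (fixed_iso_subgroups G \<sigma> H)"
proof (rule bij_betw_byWitness[where f' = "\<lambda>K. (torsion G a K, torsion G b K)"])
  have cardt: "card (torsion G a K) = a" "card (torsion G b K) = b"
    if "subgroup K G" "card K = a * b" for K
    using card_torsion[OF that(1) subgroup_finite[OF fin that(1)]] that(2) cop
    by (metis coprime_commute mult.commute)+
  have subH: "subgroup (torsion G n H) G" for n using subgroup_torsion[OF H] .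
  have A: "subgroup X G \<and> card X = a \<and> \<sigma> ` X = X \<and> G\<lparr>carrier := X\<rparr> \<cong> G\<lparr>carrier := torsion G a H\<rparr>"
    if "X \<in> fixed_iso_subgroups G \<sigma> (torsion G a H)" for X
    using that iso_same_card[of "G\<lparr>carrier := X\<rparr>" "G\<lparr>carrier := torsion G a H\<rparr>"] cardt(1)[OF H card]
    by (auto simp: fixed_iso_subgroups_def)
  have B: "subgroup X G \<and> card X = b \<and> \<sigma> ` X = X \<and> G\<lparr>carrier := X\<rparr> \<cong> G\<lparr>carrier := torsion G b H\<rparr>"
    if "X \<in> fixed_iso_subgroups G \<sigma> (torsion G b H)" for X
    using that iso_same_card[of "G\<lparr>carrier := X\<rparr>" "G\<lparr>carrier := torsion G b H\<rparr>"] cardt(2)[OF H card]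
    by (auto simp: fixed_iso_subgroups_def)
  have K: "subgroup X G \<and> card X = a * b \<and> \<sigma> ` X = X \<and> G\<lparr>carrier := X\<rparr> \<cong> G\<lparr>carrier := H\<rparr>"
    if "X \<in> fixed_iso_subgroups G \<sigma> H" for X
    using that iso_same_card[of "G\<lparr>carrier := X\<rparr>" "G\<lparr>carrier := H\<rparr>"] card
    by (auto simp: fixed_iso_subgroups_def)
  show "\<forall>p\<in>fixed_iso_subgroups G \<sigma> (torsion G a H) \<times> fixed_iso_subgroups G \<sigma> (torsion G b H).
      (\<lambda>K. (torsion G a K, torsion G b K)) ((\<lambda>(X, Y). X <#> Y) p) = p"
  proof clarsimp
    fix X Y assume "X \<in> fixed_iso_subgroups G \<sigma> (torsion G a H)"
      "Y \<in> fixed_iso_subgroups G \<sigma> (torsion G b H)"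
    note X = A[OF this(1)] and Y = B[OF this(2)]
    have "torsion G a (X <#> Y) = X"
      using torsion_set_mult[of X Y] X Y cop by simp
    moreover have "torsion G b (Y <#> X) = Y"
      using torsion_set_mult[of Y X] X Y cop by (simp add: coprime_commute)
    moreover have "Y <#> X = X <#> Y"
    proof -
      have "x \<otimes> y = y \<otimes> x" if "x \<in> X" "y \<in> Y" for x y
        using that X Y by (meson m_comm subgroup.mem_carrier)
      then show ?thesis unfolding set_mult_def by auto metis+
    qed
    ultimately show "torsion G a (X <#> Y) = X \<and> torsion G b (X <#> Y) = Y" by simp
  qed
  show "\<forall>K\<in>fixed_iso_subgroups G \<sigma> H. (\<lambda>(X, Y). X <#> Y) (torsion G a K, torsion G b K) = K"
    using K torsion_set_mult_torsion cop by auto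
  show "(\<lambda>(X, Y). X <#> Y) ` (fixed_iso_subgroups G \<sigma> (torsion G a H) \<times> fixed_iso_subgroups G \<sigma> (torsion G b H))
      \<subseteq> fixed_iso_subgroups G \<sigma> H"
  proof clarsimp
    fix X Y assume "X \<in> fixed_iso_subgroups G \<sigma> (torsion G a H)"
      "Y \<in> fixed_iso_subgroups G \<sigma> (torsion G b H)"
    note X = A[OF this(1)] and Y = B[OF this(2)]
    have "\<sigma> ` (X <#> Y) = \<sigma> ` X <#> \<sigma> ` Y"
    proof -
      have "\<sigma> (x \<otimes> y) = \<sigma> x \<otimes> \<sigma> y" if "x \<in> X" "y \<in> Y" for x y
        using that aut X Y by (metis hom_mult iso_imp_homomorphism subgroup.mem_carrier)
      then show ?thesis unfolding set_mult_def by (auto simp: image_iff) blast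
    qed
    then have "\<sigma> ` (X <#> Y) = X <#> Y" using X Y by simp
    moreover have "X \<inter> Y \<subseteq> {\<one>}"
      using subgroup_Int_coprime X Y cop by blast
    then have "G\<lparr>carrier := X <#> Y\<rparr> \<cong> G\<lparr>carrier := torsion G a H <#> torsion G b H\<rparr>"
      using set_mult_iso_cong[OF _ _ _ subH subH torsion_Int_torsion[OF H cop]] X Y by blast
    moreover have "subgroup (X <#> Y) G" using mult_subgroups X Y by blast
    ultimately show "X <#> Y \<in> fixed_iso_subgroups G \<sigma> H"
      using torsion_set_mult_torsion[OF H card cop] by (simp add: fixed_iso_subgroups_def)
  qed
  show "(\<lambda>K. (torsion G a K, torsion G b K)) ` fixed_iso_subgroups G \<sigma> H
      \<subseteq> fixed_iso_subgroups G \<sigma> (torsion G a H) \<times> fixed_iso_subgroups G \<sigma> (torsion G b H)"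
  proof -
    have "torsion G n X \<in> fixed_iso_subgroups G \<sigma> (torsion G n H)"
      if "X \<in> fixed_iso_subgroups G \<sigma> H" for X n
    proof -
      note X = K[OF that]
      have "\<sigma> \<in> iso (G\<lparr>carrier := X\<rparr>) (G\<lparr>carrier := X\<rparr>)"
        using aut X subgroup.mem_carrier[of X G]
        by (auto simp: iso_def hom_def bij_betw_def inj_on_def)
      then have "\<sigma> ` torsion G n X = torsion G n X"
        using iso_imp_image_torsion X by blast
      then show ?thesis
        using X subgroup_torsion iso_torsion[OF _ H] by (simp add: fixed_iso_subgroups_def)
    qed
    then show ?thesis by auto
  qed
qed

lemma card_fixed_iso_subgroups_mult:
  assumes "finite (carrier G)" "\<sigma> \<in> iso G G" "subgroup H G" "card H = a * b" "coprime a b"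
  shows "card (fixed_iso_subgroups G \<sigma> H) =
    card (fixed_iso_subgroups G \<sigma> (torsion G a H)) * card (fixed_iso_subgroups G \<sigma> (torsion G b H))"
  using bij_betw_same_card[OF bij_betw_fixed_iso_subgroups[OF assms]]
  by (simp add: card_cartesian_product)

lemma fixed_iso_subgroups_card_1:
  assumes aut: "\<sigma> \<in> iso G G" and H: "subgroup H G" "card H = 1"
  shows "fixed_iso_subgroups G \<sigma> H = {H}"
proof -
  have triv: "K = {\<one>}" if "subgroup K G" "card K = 1" for K
    using that subgroup.one_closed[OF that(1)] by (metis card_1_singletonE singletonD)
  have "\<sigma> \<one> = \<one>"
    using aut by (metis hom_one is_group iso_imp_homomorphism)
  then have "\<sigma> ` H = H" using triv[OF H] by simp
  moreover have "K = H" if "subgroup K G" "G\<lparr>carrier := K\<rparr> \<cong> G\<lparr>carrier := H\<rparr>" for K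
    using iso_same_card[OF that(2)] triv[OF H] triv[OF that(1)] H by simp
  ultimately show ?thesis using H iso_refl by (auto simp: fixed_iso_subgroups_def)
qed

text \<open>Splitting off one factor at a time; passing to the torsion of the remaining factors does not change
their own torsion parts.\<close>
lemma card_fixed_iso_subgroups_prod:
  assumes fin: "finite (carrier G)" and aut: "\<sigma> \<in> iso G G" and J: "finite J"
    and cop: "\<And>i j. i \<in> J \<Longrightarrow> j \<in> J \<Longrightarrow> i \<noteq> j \<Longrightarrow> coprime (n i) (n j)"
    and H: "subgroup H G" "card H = (\<Prod>i\<in>J. n i)"
  shows "card (fixed_iso_subgroups G \<sigma> H) =
    (\<Prod>i\<in>J. card (fixed_iso_subgroups G \<sigma> (torsion G (n i) H)))"
  using J cop H
proof (induction J arbitrary: H rule: finite_induct)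
  case empty
  then show ?case using fixed_iso_subgroups_card_1[OF aut] by simp
next
  case (insert j J)
  have c: "coprime (n j) (\<Prod>i\<in>J. n i)"
    using insert.hyps insert.prems(1) by (intro prod_coprime_right) auto
  have card: "card H = n j * (\<Prod>i\<in>J. n i)" using insert by simp
  let ?L = "torsion G (\<Prod>i\<in>J. n i) H"
  have L: "subgroup ?L G" using subgroup_torsion insert.prems(2) by blast
  have "card ?L = (\<Prod>i\<in>J. n i)"
    using card_torsion[OF insert.prems(2) subgroup_finite[OF fin insert.prems(2)]] card c
    by (metis coprime_commute mult.commute)
  then have "card (fixed_iso_subgroups G \<sigma> ?L) =
      (\<Prod>i\<in>J. card (fixed_iso_subgroups G \<sigma> (torsion G (n i) ?L)))"
    using insert.IH[of ?L] L insert.prems(1) by blast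
  also have "\<dots> = (\<Prod>i\<in>J. card (fixed_iso_subgroups G \<sigma> (torsion G (n i) H)))"
  proof (rule prod.cong)
    fix i assume i: "i \<in> J"
    have "x [^] (\<Prod>i\<in>J. n i) = \<one>" if "x \<in> H" "x [^] n i = \<one>" for x
    proof -
      have xc: "x \<in> carrier G"
        using that(1) subgroup.mem_carrier[OF insert.prems(2)] by blast
      have "n i dvd (\<Prod>i\<in>J. n i)" using insert.hyps(1) i by (rule dvd_prodI)
      then show ?thesis
        using that xc pow_eq_id by (metis dvd_trans)
    qed
    then have "torsion G (n i) ?L = torsion G (n i) H"
      by (auto simp: torsion_def)
    then show "card (fixed_iso_subgroups G \<sigma> (torsion G (n i) ?L)) =
        card (fixed_iso_subgroups G \<sigma> (torsion G (n i) H))" by simp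
  qed simp
  finally show ?case
    using card_fixed_iso_subgroups_mult[OF fin aut insert.prems(2) card c] insert.hyps by simp
qed

text \<open>Applied to a Sylow subgroup of an abelian group, this identifies it with the elements of
prime-power order.\<close>
lemma subgroup_eq_torsion:
  assumes fin: "finite (carrier G)" and H: "subgroup H G" "card H = a * b" "coprime a b"
    and P: "subgroup P G" "P \<subseteq> H" "card P = a"
  shows "torsion G a H = P"
proof -
  have finH: "finite H" using subgroup_finite[OF fin H(1)] .
  have "P \<subseteq> torsion G a H"
    using P pow_card_subgroup[OF P(1)] by (auto simp: torsion_def)
  then show ?thesis
    using card_torsion[OF H(1) finH H(2,3)] P(3) finH
    by (metis (no_types, lifting) card_subset_eq finite_subset mem_Collect_eq subsetI torsion_def)
qed

end

section \<open>Cyclic groups and the Klein four-group\<close>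

lemma (in group) power_iso_integer_mod_group:
  assumes x: "x \<in> carrier G" and n: "ord x = n" "n > 0"
  shows "(\<lambda>k::int. x [^] k) \<in> iso (integer_mod_group n) (G\<lparr>carrier := generate G {x}\<rparr>)"
proof -
  have red: "x [^] (k mod int n) = x [^] k" for k :: int
    using int_pow_eq[OF x, of "k mod int n" k] n by (simp add: mod_eq_dvd_iff minus_mod_eq_mult_div)
  have car: "carrier (integer_mod_group n) = {0..<int n}"
    using n(2) by (simp add: carrier_integer_mod_group)
  have "inj_on (\<lambda>k::int. x [^] k) {0..<int n}"
  proof (rule inj_onI)
    fix i j assume "i \<in> {0..<int n}" "j \<in> {0..<int n}" "x [^] i = x [^] j"
    then show "i = j"
      using int_pow_eq[OF x, of i j] n
      by (metis atLeastLessThan_iff mod_eq_dvd_iff mod_pos_pos_trivial)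
  qed
  moreover have "(\<lambda>k::int. x [^] k) ` {0..<int n} = generate G {x}"
  proof -
    have "x [^] k \<in> (\<lambda>k::int. x [^] k) ` {0..<int n}" for k :: int
      using red[of k] n(2) by (intro image_eqI[of _ _ "k mod int n"]) auto
    then show ?thesis by (auto simp: generate_pow[OF x])
  qed
  ultimately show ?thesis
    using x red by (auto simp: iso_def hom_def bij_betw_def car int_pow_mult)
qed

text \<open>Hence cyclic groups of the same finite order are isomorphic.\<close>
lemma (in group) generate_cong_integer_mod_group:
  assumes x: "x \<in> carrier G" and n: "ord x = n" "n > 0"
  shows "G\<lparr>carrier := generate G {x}\<rparr> \<cong> integer_mod_group n"
  using group.iso_sym[OF group_integer_mod_group is_isoI[OF power_iso_integer_mod_group[OF assms]]] .

lemma (in group) cyclic_subgroup_iff: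
  assumes K: "subgroup K G"
  shows "cyclic_group (G\<lparr>carrier := K\<rparr>) \<longleftrightarrow> (\<exists>x\<in>K. K = generate G {x})"
proof -
  interpret K: group "G\<lparr>carrier := K\<rparr>" using subgroup_imp_group[OF K] .
  have "range (\<lambda>n::int. x [^]\<^bsub>G\<lparr>carrier := K\<rparr>\<^esub> n) = generate G {x}" if "x \<in> K" for x
    using int_pow_consistent[OF K that] generate_pow[OF subgroup.mem_carrier[OF K that]] by auto
  then show ?thesis using K.cyclic_group by simp
qed

lemma (in group) cyclic_subgroup_finite_iff:
  assumes K: "subgroup K G" and fin: "finite K"
  shows "cyclic_group (G\<lparr>carrier := K\<rparr>) \<longleftrightarrow> (\<exists>x\<in>K. ord x = card K)"
proof -
  have "K = generate G {x} \<longleftrightarrow> ord x = card K" if "x \<in> K" for x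
  proof -
    have "generate G {x} \<subseteq> K" using generate_subgroup_incl[of "{x}" K] K that by simp
    then show ?thesis
      using generate_pow_card[OF subgroup.mem_carrier[OF K that]] fin by (metis card_subset_eq)
  qed
  then show ?thesis using cyclic_subgroup_iff[OF K] by auto
qed

lemma klein_four_not_cyclic: "\<not> cyclic_group klein_four"
proof
  interpret K: group klein_four by (simp add: DirProd_group)
  assume "cyclic_group klein_four"
  then obtain x where x: "x \<in> carrier klein_four" "subgroup_generated klein_four {x} = klein_four"
    by (auto simp: cyclic_group_def)
  have "K.ord x = order klein_four"
    using K.cyclic_order_is_ord[OF x(1)] x(2) by simp
  also have "\<dots> = 4"
    by (simp add: order_def carrier_integer_mod_group card_cartesian_product)
  finally have "K.ord x = 4" .
  moreover have "x [^]\<^bsub>klein_four\<^esub> (2::nat) = \<one>\<^bsub>klein_four\<^esub>"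
    using x(1) by (auto simp: numeral_2_eq_2 carrier_integer_mod_group DirProd_def)
  then have "K.ord x dvd 2" using K.pow_eq_id[OF x(1)] by blast
  ultimately show False by simp
qed

text \<open>Without an element of order 4 all nontrivial elements are involutions, and any two distinct ones
generate the group as an internal direct product.\<close>
lemma (in comm_group) noncyclic_order_4_iso_klein_four:
  assumes P: "subgroup P G" "card P = 4" and nc: "\<not> cyclic_group (G\<lparr>carrier := P\<rparr>)"
  shows "G\<lparr>carrier := P\<rparr> \<cong> klein_four"
proof -
  have finP: "finite P" using P(2) by (metis card.infinite zero_neq_numeral)
  have car: "x \<in> carrier G" if "x \<in> P" for x using that subgroup.mem_carrier[OF P(1)] by blast
  have ord2: "ord x = 2" if "x \<in> P" "x \<noteq> \<one>" for x
  proof -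
    have "ord x dvd 2 ^ 2"
      using pow_card_subgroup[OF P(1) that(1)] P(2) pow_eq_id[OF car[OF that(1)]] by simp
    then obtain i where i: "i \<le> 2" "ord x = 2 ^ i"
      by (metis divides_primepow_nat two_is_prime_nat)
    have "ord x \<noteq> 4" using nc cyclic_subgroup_finite_iff[OF P(1) finP] P(2) that by metis
    moreover have "ord x \<noteq> 1" using that car ord_eq_1 by blast
    ultimately show ?thesis using i by (auto simp: le_Suc_eq numeral_2_eq_2)
  qed
  have "\<not> P \<subseteq> {\<one>}" using card_mono[of "{\<one>}" P] P(2) by auto
  then obtain x where x: "x \<in> P" "x \<noteq> \<one>" by blast
  have "\<not> P \<subseteq> {\<one>, x}" using card_mono[of "{\<one>, x}" P] P(2) x by auto
  then obtain y where y: "y \<in> P" "y \<noteq> \<one>" "y \<noteq> x" by blast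
  have gen: "generate G {z} = {\<one>, z}" if "z \<in> P" "z \<noteq> \<one>" for z
  proof -
    have "{\<one>, z} \<subseteq> generate G {z}" by (auto intro: generate.intros)
    moreover have "card (generate G {z}) = 2" "card {\<one>, z} = 2"
      using generate_pow_card[OF car[OF that(1)]] ord2[OF that] that by auto
    ultimately show ?thesis
      by (metis card.infinite card_subset_eq zero_neq_numeral)
  qed
  have sub: "subgroup {\<one>, x} G" "subgroup {\<one>, y} G"
    using generate_is_subgroup[of "{x}"] generate_is_subgroup[of "{y}"] gen x y car by auto
  have int: "{\<one>, x} \<inter> {\<one>, y} \<subseteq> {\<one>}" using y by auto
  have "{\<one>, x} <#> {\<one>, y} \<subseteq> P"
    using x y subgroup.m_closed[OF P(1)] subgroup.one_closed[OF P(1)] by (auto simp: set_mult_def)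
  moreover have "card ({\<one>, x} <#> {\<one>, y}) = 4"
    using card_set_mult[OF sub int] x y by simp
  ultimately have eq: "{\<one>, x} <#> {\<one>, y} = P"
    using P(2) finP by (metis card_subset_eq)
  have i: "G\<lparr>carrier := {\<one>, z}\<rparr> \<cong> integer_mod_group 2" if "z \<in> P" "z \<noteq> \<one>" for z
    using generate_cong_integer_mod_group[OF car[OF that(1)] ord2[OF that]] gen[OF that] by simp
  interpret X: group "G\<lparr>carrier := {\<one>, x}\<rparr>" using subgroup_imp_group[OF sub(1)] .
  interpret Y: group "G\<lparr>carrier := {\<one>, y}\<rparr>" using subgroup_imp_group[OF sub(2)] .
  have "G\<lparr>carrier := {\<one>, x}\<rparr> \<times>\<times> G\<lparr>carrier := {\<one>, y}\<rparr> \<cong> klein_four"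
    using X.DirProd_iso_trans i x y by blast
  moreover have "G\<lparr>carrier := {\<one>, x}\<rparr> \<times>\<times> G\<lparr>carrier := {\<one>, y}\<rparr> \<cong> G\<lparr>carrier := P\<rparr>"
    using is_isoI[OF mult_iso_set_mult[OF sub int]] eq by simp
  then have "G\<lparr>carrier := P\<rparr> \<cong> G\<lparr>carrier := {\<one>, x}\<rparr> \<times>\<times> G\<lparr>carrier := {\<one>, y}\<rparr>"
    using group.iso_sym[OF DirProd_group[OF X.is_group Y.is_group]] by blast
  ultimately show ?thesis by (rule iso_trans[rotated])
qed

section \<open>Counting subgroups of prime-power order\<close>

lemma (in group) card_generators:
  assumes fin: "finite (carrier G)" and x: "x \<in> carrier G"
  shows "card {y \<in> generate G {x}. ord y = ord x} = totient (ord x)"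
proof -
  let ?n = "ord x"
  have n: "?n > 0" using ord_ge_1[OF fin x] by simp
  have "{y \<in> generate G {x}. ord y = ?n} = (\<lambda>k::nat. x [^] k) ` totatives ?n"
  proof (intro Set.set_eqI iffI)
    fix y assume y: "y \<in> {y \<in> generate G {x}. ord y = ?n}"
    then obtain k :: nat where k: "y = x [^] k"
      using generate_pow_nat[OF x] n by auto
    have cop: "coprime k ?n"
      using y k pow_ord_eq_ord_iff[OF fin x] by simp
    \<comment> \<open>Totatives of \<open>n\<close> lie in \<open>{1..n}\<close>, so the residue 0 is represented by \<open>n\<close>; this occurs only for \<open>n = 1\<close>.\<close>
    define k' where "k' = (if k mod ?n = 0 then ?n else k mod ?n)"
    have kk: "k' mod ?n = k mod ?n" unfolding k'_def by simp
    then have "x [^] k' = x [^] k"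
      using x pow_eq_id by (metis int_pow_eq int_pow_int mod_eq_dvd_iff of_nat_mod)
    moreover have "coprime k' ?n"
      using cop kk n by (metis coprime_mod_left_iff neq0_conv)
    moreover have "k' > 0" "k' \<le> ?n"
      using n mod_less_divisor[OF n, of k] unfolding k'_def by auto
    ultimately show "y \<in> (\<lambda>k::nat. x [^] k) ` totatives ?n"
      using k by (auto simp: totatives_def image_iff)
  next
    fix y assume "y \<in> (\<lambda>k::nat. x [^] k) ` totatives ?n"
    then obtain k where k: "y = x [^] k" "coprime k ?n" by (auto simp: totatives_def)
    then show "y \<in> {y \<in> generate G {x}. ord y = ?n}"
      using pow_ord_eq_ord_iff[OF fin x] generate_pow_nat[OF x] n by auto
  qed
  moreover have "inj_on (\<lambda>k::nat. x [^] k) (totatives ?n)"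
    using ord_inj'[OF x] by (rule inj_on_subset) (auto simp: totatives_def)
  ultimately show ?thesis by (simp add: card_image totient_def)
qed

text \<open>Sort the elements of order \<open>n\<close> by the subgroup that they generate: every cyclic subgroup of
order \<open>n\<close> is hit by its \<open>totient n\<close> generators.\<close>
lemma (in group) card_cyclic_subgroups_mult_totient:
  assumes fin: "finite (carrier G)"
  shows "card ((\<lambda>x. generate G {x}) ` {x \<in> carrier G. ord x = n}) * totient n =
    card {x \<in> carrier G. ord x = n}"
proof -
  let ?E = "{x \<in> carrier G. ord x = n}" and ?g = "\<lambda>x. generate G {x}"
  have finE: "finite ?E" using fin by simp
  have fib: "{y. y \<in> ?E \<and> ?g y = ?g x} = {y \<in> ?g x. ord y = ord x}" if x: "x \<in> ?E" for x
  proof -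
    have gx: "finite (?g x)" "?g x \<subseteq> carrier G"
      using generate_incl[of "{x}"] x fin by (auto intro: finite_subset)
    have sub: "?g y = ?g x" if "y \<in> ?g x" "ord y = n" for y
    proof -
      have "?g y \<subseteq> ?g x"
        using generate_subgroup_incl[of "{y}" "?g x"] generate_is_subgroup[of "{x}"] that x by simp
      moreover have "card (?g y) = card (?g x)"
        using generate_pow_card[of x] generate_pow_card[of y] that x gx by auto
      ultimately show ?thesis using gx by (simp add: card_subset_eq)
    qed
    have mem: "y \<in> ?g y" for y by (simp add: generate.incl)
    show ?thesis
    proof (intro Set.set_eqI iffI)
      fix y assume "y \<in> {y. y \<in> ?E \<and> ?g y = ?g x}"
      then show "y \<in> {y \<in> ?g x. ord y = ord x}" using mem[of y] x by simp
    next
      fix y assume "y \<in> {y \<in> ?g x. ord y = ord x}"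
      then show "y \<in> {y. y \<in> ?E \<and> ?g y = ?g x}" using sub[of y] gx(2) x by auto
    qed
  qed
  have "card ?E = (\<Sum>C\<in>?g ` ?E. card {y. y \<in> ?E \<and> ?g y = C})"
    using sum.image_gen[OF finE, of "\<lambda>_. 1::nat" ?g] by simp
  also have "\<dots> = (\<Sum>C\<in>?g ` ?E. totient n)"
    using fib card_generators[OF fin] by (intro sum.cong) auto
  finally show ?thesis by simp
qed

lemma (in group) fixed_iso_subgroups_cyclic:
  assumes fin: "finite (carrier G)" and P: "subgroup P G" "cyclic_group (G\<lparr>carrier := P\<rparr>)"
  shows "fixed_iso_subgroups G id P = (\<lambda>x. generate G {x}) ` {x \<in> carrier G. ord x = card P}"
proof -
  obtain p where p: "p \<in> P" "P = generate G {p}"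
    using cyclic_subgroup_iff[OF P(1)] P(2) by blast
  have pc: "p \<in> carrier G" "ord p = card P" "card P > 0"
    using p(1) subgroup.mem_carrier[OF P(1)] generate_pow_card[of p] p(2)[symmetric]
      finite_subset[OF subgroup.subset[OF P(1)] fin] by (auto simp: card_gt_0_iff)
  have Pi: "G\<lparr>carrier := P\<rparr> \<cong> integer_mod_group (card P)"
    using generate_cong_integer_mod_group[of p "card P"] pc p by simp
  have gP: "group (G\<lparr>carrier := P\<rparr>)" using subgroup_imp_group[OF P(1)] .
  show ?thesis
  proof (intro Set.set_eqI iffI)
    fix K assume "K \<in> fixed_iso_subgroups G id P"
    then have K: "subgroup K G" "G\<lparr>carrier := K\<rparr> \<cong> G\<lparr>carrier := P\<rparr>"
      by (auto simp: fixed_iso_subgroups_def)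
    have "cyclic_group (G\<lparr>carrier := K\<rparr>)"
      using isomorphic_group_cyclicity[OF K(2) subgroup_imp_group[OF K(1)] gP] P(2) by blast
    then obtain x where x: "x \<in> K" "K = generate G {x}"
      using cyclic_subgroup_iff[OF K(1)] by blast
    then have "x \<in> carrier G" "ord x = card P"
      using subgroup.mem_carrier[OF K(1)] generate_pow_card[of x] iso_same_card[OF K(2)] by auto
    then show "K \<in> (\<lambda>x. generate G {x}) ` {x \<in> carrier G. ord x = card P}" using x by blast
  next
    fix K assume "K \<in> (\<lambda>x. generate G {x}) ` {x \<in> carrier G. ord x = card P}"
    then obtain x where x: "x \<in> carrier G" "ord x = card P" "K = generate G {x}" by blast
    then have K: "subgroup K G" using generate_is_subgroup[of "{x}"] by simp
    have "G\<lparr>carrier := K\<rparr> \<cong> integer_mod_group (card P)"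
      using generate_cong_integer_mod_group[OF x(1,2)] pc x by simp
    then have "G\<lparr>carrier := K\<rparr> \<cong> G\<lparr>carrier := P\<rparr>"
      using group.iso_sym[OF gP Pi] by (rule iso_trans)
    then show "K \<in> fixed_iso_subgroups G id P" using K by (simp add: fixed_iso_subgroups_def)
  qed
qed

text \<open>By the torsion hypothesis, \<open>l ^ j\<close> with \<open>j \<le> \<beta>\<close> kills as many elements as in a product of two
cyclic groups of order divisible by \<open>l ^ \<beta>\<close>. Elements of order \<open>l ^ \<beta>\<close> are those
killed by \<open>l ^ \<beta>\<close> but not by \<open>l ^ (\<beta> - 1)\<close>, and dividing their number by the number of generators
\<open>l ^ (\<beta> - 1) * (l - 1)\<close> of a single subgroup gives the result.\<close>
lemma (in group) card_fixed_iso_subgroups_cyclic: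
  assumes fin: "finite (carrier G)" and P: "subgroup P G" "cyclic_group (G\<lparr>carrier := P\<rparr>)"
    and l: "prime l" "card P = l ^ \<beta>" "\<beta> > 0"
    and tor: "\<And>j. j \<le> \<beta> \<Longrightarrow> card (torsion G (l ^ j) (carrier G)) = (l ^ j)\<^sup>2"
  shows "card (fixed_iso_subgroups G id P) = l ^ \<beta> + l ^ (\<beta> - 1)"
proof -
  obtain b where b: "\<beta> = Suc b" using l(3) gr0_implies_Suc by blast
  have l1: "l > 1" using prime_gt_1_nat[OF l(1)] .
  let ?T = "\<lambda>j. torsion G (l ^ j) (carrier G)"
  have "{x \<in> carrier G. ord x = l ^ \<beta>} = ?T \<beta> - ?T b"
  proof -
    have "ord x = l ^ \<beta> \<longleftrightarrow> ord x dvd l ^ \<beta> \<and> \<not> ord x dvd l ^ b" if "x \<in> carrier G" for x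
    proof
      assume "ord x = l ^ \<beta>"
      then show "ord x dvd l ^ \<beta> \<and> \<not> ord x dvd l ^ b"
        using l1 b by (auto dest: dvd_imp_le)
    next
      assume d: "ord x dvd l ^ \<beta> \<and> \<not> ord x dvd l ^ b"
      then obtain i where i: "i \<le> \<beta>" "ord x = l ^ i"
        using divides_primepow_nat[OF l(1)] by blast
      then have "\<not> i \<le> b" using d le_imp_power_dvd[of i b l] by auto
      then show "ord x = l ^ \<beta>" using i b by (simp add: le_Suc_eq)
    qed
    then show ?thesis unfolding torsion_def using pow_eq_id by blast
  qed
  moreover have "?T b \<subseteq> ?T \<beta>"
  proof -
    have "l ^ b dvd l ^ \<beta>" using b by simp
    then show ?thesis unfolding torsion_def using pow_eq_id dvd_trans by blast
  qed
  moreover have "finite (?T b)" using fin by (simp add: torsion_def)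
  ultimately have "card {x \<in> carrier G. ord x = l ^ \<beta>} = (l ^ \<beta>)\<^sup>2 - (l ^ b)\<^sup>2"
    using tor[of \<beta>] tor[of b] b by (simp add: card_Diff_subset)
  then have "card (fixed_iso_subgroups G id P) * (l ^ b * (l - 1)) = (l ^ \<beta>)\<^sup>2 - (l ^ b)\<^sup>2"
    using card_cyclic_subgroups_mult_totient[OF fin, of "l ^ \<beta>"]
      fixed_iso_subgroups_cyclic[OF fin P] l totient_prime_power[OF l(1,3)] b by simp
  also have "\<dots> = (l ^ \<beta> + l ^ b) * (l ^ b * (l - 1))"
  proof -
    obtain k where k: "l = Suc k" using l1 by (cases l) auto
    have "(l ^ \<beta>)\<^sup>2 = (l ^ \<beta> + l ^ b) * (l ^ b * (l - 1)) + (l ^ b)\<^sup>2"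
      unfolding b k by (simp add: algebra_simps power2_eq_square)
    then show ?thesis by simp
  qed
  finally show ?thesis using l1 b by simp
qed

text \<open>Without an element of order \<open>l ^ \<beta>\<close>, everything in \<open>P\<close> is killed by \<open>l ^ (\<beta> - 1)\<close>. For \<open>\<beta> \<le> 2\<close>
this puts \<open>P\<close> inside the \<open>l\<close>-torsion of the whole group, which is too small to be larger than \<open>P\<close>.
So a noncyclic Sylow subgroup leaves no choice at all.\<close>
lemma (in comm_group) noncyclic_prime_square_eq_torsion:
  assumes P: "subgroup P G" and nc: "\<not> cyclic_group (G\<lparr>carrier := P\<rparr>)"
    and l: "prime l" "card P = l ^ \<beta>" "\<beta> \<le> 2"
    and tor: "finite (torsion G l (carrier G))" "card (torsion G l (carrier G)) \<le> l\<^sup>2"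
  shows "\<beta> = 2" "P = torsion G l (carrier G)"
proof -
  have l1: "l > 1" using prime_gt_1_nat[OF l(1)] .
  have finP: "finite P" using l(2) l1 by (metis card.infinite not_one_less_zero power_eq_0_iff)
  have car: "x \<in> carrier G" if "x \<in> P" for x using that subgroup.mem_carrier[OF P] by blast
  have dvd: "ord x dvd l ^ (\<beta> - 1)" if x: "x \<in> P" for x
  proof -
    have "ord x dvd l ^ \<beta>" using pow_card_subgroup[OF P x] l(2) pow_eq_id[OF car[OF x]] by simp
    then obtain i where i: "i \<le> \<beta>" "ord x = l ^ i" using divides_primepow_nat[OF l(1)] by blast
    have "i \<noteq> \<beta>" using nc cyclic_subgroup_finite_iff[OF P finP] i(2) l(2) x by metis
    then have "i \<le> \<beta> - 1" using i by simp
    then show ?thesis using i(2) by (simp add: le_imp_power_dvd)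
  qed
  show b: "\<beta> = 2"
  proof (rule ccontr)
    assume "\<beta> \<noteq> 2"
    then have "\<beta> - 1 = 0" using l(3) by simp
    then have "x = \<one>" if "x \<in> P" for x
      using dvd[OF that] ord_eq_1[OF car[OF that]] by simp
    then have "P = {\<one>}" using subgroup.one_closed[OF P] by blast
    then show False using nc cyclic_subgroup_finite_iff[OF P finP] by simp
  qed
  have "P \<subseteq> torsion G l (carrier G)"
  proof
    fix x assume x: "x \<in> P"
    then show "x \<in> torsion G l (carrier G)"
      using dvd[OF x] car[OF x] pow_eq_id[OF car[OF x], of l] b by (simp add: torsion_def)
  qed
  then show "P = torsion G l (carrier G)"
    using tor l(2) b by (simp add: card_seteq)
qed

lemma (in comm_group) fixed_iso_subgroups_noncyclic:
  assumes aut: "\<sigma> \<in> iso G G"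
    and P: "subgroup P G" and nc: "\<not> cyclic_group (G\<lparr>carrier := P\<rparr>)"
    and l: "prime l" "card P = l ^ \<beta>" "\<beta> \<le> 2"
    and tor: "finite (torsion G l (carrier G))" "card (torsion G l (carrier G)) \<le> l\<^sup>2"
  shows "fixed_iso_subgroups G \<sigma> P = {P}"
proof -
  note eq = noncyclic_prime_square_eq_torsion(2)[OF _ _ l(1) _ l(3) tor]
  have "K = P" if "subgroup K G" "G\<lparr>carrier := K\<rparr> \<cong> G\<lparr>carrier := P\<rparr>" for K
  proof -
    have "\<not> cyclic_group (G\<lparr>carrier := K\<rparr>)"
      using nc isomorphic_group_cyclicity[OF that(2)] subgroup_imp_group that(1) P by blast
    moreover have "card K = l ^ \<beta>" using iso_same_card[OF that(2)] l(2) by simp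
    ultimately have "K = torsion G l (carrier G)" using eq[OF that(1)] by blast
    then show ?thesis using eq[OF P nc l(2)] by metis
  qed
  moreover have "\<sigma> ` P = P"
  proof -
    have "\<sigma> ` torsion G l (carrier G) = torsion G l (carrier G)"
      using iso_imp_image_torsion[OF subgroup_self subgroup_self, of \<sigma> l] aut by simp
    then show ?thesis using eq[OF P nc l(2)] by metis
  qed
  ultimately show ?thesis
    using P iso_refl by (auto simp: fixed_iso_subgroups_def)
qed

section \<open>Roots of unity in finite fields\<close>

lemma card_roots_of_unity_le:
  fixes n :: nat
  assumes "n > 0"
  shows "card {z :: 'a::field. z ^ n = 1} \<le> n"
proof -
  let ?p = "Polynomial.monom 1 n - 1 :: 'a poly"
  have "Polynomial.coeff ?p n = 1" using assms by simp
  then have "?p \<noteq> 0" by (metis Polynomial.coeff_0 zero_neq_one)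
  then have "card {z. poly ?p z = 0} \<le> degree ?p" by (rule card_poly_roots_bound)
  also have "\<dots> \<le> n" by (intro degree_diff_le) (auto simp: degree_monom_le)
  finally show ?thesis by (simp add: poly_monom)
qed

lemma finite_field_power_card_minus_one:
  fixes x :: "'a::{field,finite}"
  assumes "x \<noteq> 0"
  shows "x ^ (CARD('a) - 1) = 1"
proof -
  have "(\<Prod>y\<in>UNIV-{0}. x * y) = (\<Prod>y\<in>UNIV-{0}. y)"
    by (rule prod.reindex_bij_witness[of _ "\<lambda>y. y / x" "\<lambda>y. x * y"]) (use assms in auto)
  then have "x ^ (CARD('a) - 1) * \<Prod>(UNIV - {0}) = \<Prod>(UNIV - {0} :: 'a set)"
    by (simp add: prod.distrib card_Diff_singleton)
  moreover have "\<Prod>(UNIV - {0} :: 'a set) \<noteq> 0" by simp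
  ultimately show ?thesis by simp
qed

text \<open>On the units, the \<open>n\<close>-th power map has fibres as large as the set of \<open>n\<close>-th roots of unity, and its
image consists of roots of unity of the complementary order \<open>c\<close>, of which there are at most \<open>c\<close>.
Hence \<open>n * c\<close>, the number of units, is at most \<open>c\<close> times the number of \<open>n\<close>-th roots.\<close>
lemma card_roots_of_unity:
  assumes n: "n dvd CARD('a::{field,finite}) - 1"
  shows "card {z :: 'a. z ^ n = 1} = n"
proof -
  let ?U = "UNIV - {0 :: 'a}" and ?R = "\<lambda>n. {z :: 'a. z ^ n = 1}"
  obtain c where c: "CARD('a) - 1 = n * c" using n by blast
  have "card {0, 1 :: 'a} \<le> CARD('a)" by (rule card_mono) auto
  then have q: "n * c > 0" unfolding c[symmetric] by simp
  have fib: "card {x. x \<in> ?U \<and> x ^ n = y} = card (?R n)" if y: "y \<in> (\<lambda>x. x ^ n) ` ?U" for y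
  proof -
    obtain x where x: "x \<noteq> 0" "y = x ^ n" using y by auto
    have "bij_betw (\<lambda>z. x * z) (?R n) {x. x \<in> ?U \<and> x ^ n = y}"
      by (rule bij_betw_byWitness[where f' = "\<lambda>z. z / x"])
        (use x q in \<open>auto simp: power_mult_distrib power_divide power_0_left\<close>)
    then show ?thesis using bij_betw_same_card[symmetric] by blast
  qed
  have "n * c = card ?U" using c by (simp add: card_Diff_singleton)
  also have "\<dots> = (\<Sum>y\<in>(\<lambda>x. x ^ n) ` ?U. card {x. x \<in> ?U \<and> x ^ n = y})"
    using sum.image_gen[of ?U "\<lambda>_. 1::nat" "\<lambda>x. x ^ n"] by simp
  also have "\<dots> = card ((\<lambda>x. x ^ n) ` ?U) * card (?R n)"
    using fib by simp
  also have "\<dots> \<le> c * card (?R n)"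
  proof (intro mult_right_mono)
    have "(\<lambda>x. x ^ n) ` ?U \<subseteq> ?R c"
      using finite_field_power_card_minus_one[where ?'a = 'a] unfolding c
      by (auto simp flip: power_mult)
    then have "card ((\<lambda>x. x ^ n) ` ?U) \<le> card (?R c)" by (intro card_mono) auto
    also have "\<dots> \<le> c" using q by (intro card_roots_of_unity_le) auto
    finally show "card ((\<lambda>x. x ^ n) ` ?U) \<le> c" .
  qed simp
  finally have "n \<le> card (?R n)" using q by simp
  then show ?thesis using card_roots_of_unity_le[of n, where ?'a = 'a] q by simp
qed

section \<open>The group of diagonal matrices\<close>

abbreviation mat2 :: "'a::zero \<Rightarrow> 'a \<Rightarrow> 'a \<Rightarrow> 'a \<Rightarrow> 'a ^ 2 ^ 2" where
  "mat2 a b c d \<equiv> vector [vector [a, b], vector [c, d]]"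

abbreviation diag2 :: "'a::zero \<Rightarrow> 'a \<Rightarrow> 'a ^ 2 ^ 2" where
  "diag2 a d \<equiv> mat2 a 0 0 d"

abbreviation diag_group :: "('a::field ^ 2 ^ 2) monoid" where
  "diag_group \<equiv> GL2\<lparr>carrier := D2\<rparr>"

text \<open>On diagonal matrices this is conjugation by the permutation matrix of the transposition; entries off
the diagonal are discarded.\<close>
definition swap_diag :: "'a::zero ^ 2 ^ 2 \<Rightarrow> 'a ^ 2 ^ 2" where
  "swap_diag A = diag2 (A $ 2 $ 2) (A $ 1 $ 1)"

lemma mat2_cases:
  obtains a b c d where "A = mat2 a b c d"
proof
  show "A = mat2 (A $ 1 $ 1) (A $ 1 $ 2) (A $ 2 $ 1) (A $ 2 $ 2)"
    by (simp add: vec_eq_iff forall_2)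
qed

lemma mat2_eq_iff [simp]:
  "mat2 a b c d = mat2 a' b' c' d' \<longleftrightarrow> a = a' \<and> b = b' \<and> c = c' \<and> d = d'"
  by (auto simp: vec_eq_iff forall_2)

lemma mat2_mult [simp]:
  fixes a :: "'a::semiring_1"
  shows "mat2 a b c d ** mat2 a' b' c' d' =
    mat2 (a * a' + b * c') (a * b' + b * d') (c * a' + d * c') (c * b' + d * d')"
  by (simp add: vec_eq_iff forall_2 matrix_matrix_mult_def sum_2)

lemma mat_1_eq_diag2: "(mat 1 :: 'a::semiring_1 ^ 2 ^ 2) = diag2 1 1"
  by (simp add: vec_eq_iff forall_2 mat_def)

lemma GL2_simps [simp]:
  "mult GL2 = (**)" "one GL2 = diag2 1 1"
  by (simp_all add: GL2_def mat_1_eq_diag2)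

lemma invertible_mat_1: "invertible (mat 1 :: 'a::semiring_1 ^ 'n ^ 'n)"
  unfolding invertible_def by (intro exI[of _ "mat 1"]) simp

lemma mat2_in_GL2_iff [simp]:
  fixes a :: "'a::field"
  shows "mat2 a b c d \<in> carrier GL2 \<longleftrightarrow> a * d - b * c \<noteq> 0"
  by (simp add: GL2_def invertible_det_nz det_2)

lemma group_GL2: "group (GL2 :: ('a::field ^ 2 ^ 2) monoid)"
proof (rule groupI)
  fix A :: "'a ^ 2 ^ 2" assume "A \<in> carrier GL2"
  then obtain B where "A ** B = mat 1" "B ** A = mat 1"
    by (auto simp: GL2_def invertible_def)
  then show "\<exists>B\<in>carrier GL2. B \<otimes>\<^bsub>GL2\<^esub> A = \<one>\<^bsub>GL2\<^esub>"
    by (intro bexI[of _ B]) (auto simp: GL2_def invertible_def)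
qed (simp_all add: GL2_def invertible_mult matrix_mul_assoc invertible_mat_1 del: GL2_simps)

lemma mem_D2_iff: "A \<in> D2 \<longleftrightarrow> (\<exists>a d. A = diag2 a d \<and> a \<noteq> 0 \<and> d \<noteq> 0)"
proof (cases A rule: mat2_cases)
  case (1 a b c d)
  then show ?thesis by (auto simp: D2_def forall_2)
qed

lemma subgroup_D2: "subgroup (D2 :: ('a::field ^ 2 ^ 2) set) GL2"
proof -
  interpret group "GL2 :: ('a ^ 2 ^ 2) monoid" by (rule group_GL2)
  show ?thesis
  proof (rule subgroupI)
    show "D2 \<subseteq> carrier (GL2 :: ('a ^ 2 ^ 2) monoid)" by (auto simp: mem_D2_iff)
    show "(D2 :: ('a ^ 2 ^ 2) set) \<noteq> {}" using mem_D2_iff[of "diag2 1 1 :: 'a ^ 2 ^ 2"] by auto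
  next
    fix A :: "'a ^ 2 ^ 2" assume "A \<in> D2"
    then obtain a d where A: "A = diag2 a d" "a \<noteq> 0" "d \<noteq> 0" by (auto simp: mem_D2_iff)
    have "inv\<^bsub>GL2\<^esub> A = diag2 (1 / a) (1 / d)"
      by (rule inv_equality) (use A in auto)
    then show "inv\<^bsub>GL2\<^esub> A \<in> D2" using A by (auto simp: mem_D2_iff)
  next
    fix A B :: "'a ^ 2 ^ 2" assume "A \<in> D2" "B \<in> D2"
    then show "A \<otimes>\<^bsub>GL2\<^esub> B \<in> D2" by (fastforce simp: mem_D2_iff)
  qed
qed

lemma comm_group_diag_group: "comm_group (diag_group :: ('a::field ^ 2 ^ 2) monoid)"
proof -
  interpret group "GL2 :: ('a ^ 2 ^ 2) monoid" by (rule group_GL2)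
  interpret D: group "diag_group :: ('a ^ 2 ^ 2) monoid"
    using subgroup_imp_group[OF subgroup_D2] .
  show ?thesis
    by (rule D.group_comm_groupI) (auto simp: mem_D2_iff mult.commute)
qed

lemma subgroup_diag_group_iff:
  "subgroup K (diag_group :: ('a::field ^ 2 ^ 2) monoid) \<longleftrightarrow> subgroup K GL2 \<and> K \<subseteq> D2"
proof -
  interpret group "GL2 :: ('a ^ 2 ^ 2) monoid" by (rule group_GL2)
  show ?thesis
    using incl_subgroup[OF subgroup_D2] subgroup_incl[OF _ subgroup_D2] subgroup.subset by fastforce
qed

lemma diag2_pow [simp]: "diag2 a d [^]\<^bsub>diag_group\<^esub> (n::nat) = diag2 (a ^ n) (d ^ n)"
  for a :: "'a::field"
  by (induction n) (auto simp: nat_pow_def mult.commute)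

lemma torsion_diag_group:
  assumes "n > 0"
  shows "torsion diag_group n D2 = (\<lambda>(a, d). diag2 a d) ` ({z :: 'a::field. z ^ n = 1} \<times> {z. z ^ n = 1})"
  using assms by (auto simp: torsion_def mem_D2_iff image_iff power_0_left)

lemma card_torsion_diag_group:
  assumes "n > 0"
  shows "card (torsion diag_group n (D2 :: ('a::field ^ 2 ^ 2) set)) = (card {z :: 'a. z ^ n = 1})\<^sup>2"
proof -
  have "inj_on (\<lambda>(a, d). diag2 a d) ({z :: 'a. z ^ n = 1} \<times> {z. z ^ n = 1})"
    by (auto simp: inj_on_def)
  then show ?thesis
    using torsion_diag_group[OF assms, where ?'a = 'a]
    by (simp add: card_image card_cartesian_product power2_eq_square)
qed

lemma swap_diag_diag2 [simp]: "swap_diag (diag2 a d) = diag2 d a"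
  by (simp add: swap_diag_def)

lemma swap_diag_iso: "swap_diag \<in> iso (diag_group :: ('a::field ^ 2 ^ 2) monoid) diag_group"
proof -
  have "bij_betw swap_diag D2 (D2 :: ('a ^ 2 ^ 2) set)"
    by (rule bij_betw_byWitness[where f' = swap_diag]) (auto simp: mem_D2_iff)
  then show ?thesis by (auto simp: iso_def hom_def mem_D2_iff)
qed

lemma diag_group_pow_card_minus_one:
  fixes A :: "'a::{field,finite} ^ 2 ^ 2"
  assumes "A \<in> D2"
  shows "A [^]\<^bsub>diag_group\<^esub> (CARD('a) - 1) = diag2 1 1"
  using assms finite_field_power_card_minus_one by (auto simp: mem_D2_iff)

section \<open>Cyclic subgroups invariant under the swap\<close>

text \<open>The only square roots of 1 modulo \<open>l ^ \<beta>\<close> are \<open>1\<close> and \<open>-1\<close>. An odd prime cannot divide both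
factors; for \<open>l = 2\<close> the bound on \<open>\<beta>\<close> matters, since \<open>3\<close> is another square root of 1 modulo 8.\<close>
lemma dvd_pred_mult_succ_cases:
  fixes t l \<beta> :: nat
  assumes l: "prime l" "\<beta> \<le> 2" and d: "l ^ \<beta> dvd (t - 1) * (t + 1)" and t: "t > 0"
  shows "l ^ \<beta> dvd t - 1 \<or> l ^ \<beta> dvd t + 1"
proof (cases "coprime (l ^ \<beta>) (t - 1) \<or> coprime (l ^ \<beta>) (t + 1)")
  case True
  then show ?thesis using d by (metis coprime_dvd_mult_left_iff coprime_dvd_mult_right_iff)
next
  case False
  then have b: "\<beta> \<noteq> 0" and "\<not> coprime l (t - 1)" "\<not> coprime l (t + 1)"
    by (auto simp: coprime_power_left_iff)
  then have dvd: "l dvd t - 1" "l dvd t + 1"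
    using l(1) prime_imp_coprime by blast+
  moreover have "t + 1 = (t - 1) + 2" using t by simp
  ultimately have "l dvd 2" by (metis dvd_add_right_iff)
  then have l2: "l = 2" using l(1) by (metis primes_dvd_imp_eq two_is_prime_nat)
  consider "\<beta> = 1" | "\<beta> = 2" using b l(2) by linarith
  then show ?thesis
  proof cases
    case 1
    then show ?thesis using dvd by simp
  next
    case 2
    have "odd t" using dvd(2) l2 by simp
    then obtain s where s: "t = 2 * s + 1" by (elim oddE)
    have "4 dvd 2 * s \<or> 4 dvd 2 * s + 2"
      by presburger
    then show ?thesis unfolding s l2 2 by simp
  qed
qed

text \<open>If the group generated by \<open>diag2 x y\<close> is invariant under the swap, then \<open>y = x ^ t\<close> and \<open>x = y ^ t\<close>
for some \<open>t\<close>, so \<open>t\<close> is a square root of 1 modulo the order and \<open>y\<close> is \<open>x\<close> or its inverse. This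
leaves the two groups \<open>S\<close> and \<open>T\<close> below, which coincide exactly when the order is 2.\<close>
lemma card_swap_fixed_cyclic:
  fixes P :: "('a::{field,finite} ^ 2 ^ 2) set"
  assumes P: "subgroup P diag_group" "cyclic_group (diag_group\<lparr>carrier := P\<rparr>)"
    and l: "prime l" "card P = l ^ \<beta>" "0 < \<beta>" "\<beta> \<le> 2"
    and dvd: "l ^ \<beta> dvd CARD('a) - 1"
  shows "card (fixed_iso_subgroups diag_group swap_diag P) = (if l ^ \<beta> = 2 then 1 else 2)"
proof -
  interpret D: comm_group "diag_group :: ('a ^ 2 ^ 2) monoid" by (rule comm_group_diag_group)
  let ?n = "l ^ \<beta>" and ?G = "diag_group :: ('a ^ 2 ^ 2) monoid"
  let ?R = "{z :: 'a. z ^ ?n = 1}"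
  define S where "S = (\<lambda>z::'a. diag2 z z) ` ?R"
  define T where "T = (\<lambda>z::'a. diag2 z (inverse z)) ` ?R"
  have fin: "finite (carrier ?G)" by simp
  have n: "?n > 0" using l(1) by (simp add: prime_gt_0_nat)
  have nz: "z \<noteq> 0" if "z \<in> ?R" for z using that n by (auto simp: power_0_left)
  have inj: "inj_on (\<lambda>z::'a. diag2 z z) ?R" "inj_on (\<lambda>z::'a. diag2 z (inverse z)) ?R"
    by (auto simp: inj_on_def)
  have R: "card ?R = ?n" using card_roots_of_unity[OF dvd] .
  have cardS: "card S = ?n" "card T = ?n"
    unfolding S_def T_def using card_image[OF inj(1)] card_image[OF inj(2)] R by simp_all
  obtain b where b: "\<beta> = Suc b" using l(3) gr0_implies_Suc by blast
  have l1: "l > 1" using prime_gt_1_nat[OF l(1)] .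
  \<comment> \<open>There are more roots of unity for \<open>l ^ \<beta>\<close> than for \<open>l ^ b\<close>, so some \<open>a\<close> has exact order \<open>l ^ \<beta>\<close>.\<close>
  have "card {z :: 'a. z ^ (l ^ b) = 1} \<le> l ^ b"
    using l1 by (intro card_roots_of_unity_le) simp
  also have "\<dots> < ?n" using b l1 by simp
  finally have "\<not> ?R \<subseteq> {z. z ^ (l ^ b) = 1}"
    using R card_mono[of "{z :: 'a. z ^ (l ^ b) = 1}" ?R] by auto
  then obtain a :: 'a where a: "a ^ ?n = 1" "a ^ (l ^ b) \<noteq> 1" by auto
  have a0: "a \<noteq> 0" using nz a by simp
  have ordn: "D.ord A = ?n" if "A \<in> D2" "A [^]\<^bsub>?G\<^esub> ?n = diag2 1 1" "A [^]\<^bsub>?G\<^esub> (l ^ b) \<noteq> diag2 1 1" for A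
  proof -
    have "D.ord A dvd ?n" "\<not> D.ord A dvd l ^ b"
      using that D.pow_eq_id[of A] by auto
    then obtain i where i: "i \<le> \<beta>" "D.ord A = l ^ i" using divides_primepow_nat[OF l(1)] by blast
    then have "\<not> i \<le> b" using \<open>\<not> D.ord A dvd l ^ b\<close> le_imp_power_dvd[of i b l] by auto
    then show ?thesis using i b by (simp add: le_Suc_eq)
  qed
  have Fid: "fixed_iso_subgroups ?G id P = (\<lambda>x. generate ?G {x}) ` {x \<in> D2. D.ord x = ?n}"
    using D.fixed_iso_subgroups_cyclic[OF fin P] l(2) by simp
  have gen_eq: "generate ?G {A} = X"
    if A: "A \<in> D2" "D.ord A = ?n" and X: "\<And>k::nat. A [^]\<^bsub>?G\<^esub> k \<in> X" "card X = ?n" for A X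
  proof -
    have "generate ?G {A} \<subseteq> X"
      using D.generate_pow_nat[of A] A n X(1) by auto
    moreover have "card (generate ?G {A}) = ?n" using D.generate_pow_card[of A] A by simp
    moreover have "finite X" using X(2) n by (metis card.infinite less_numeral_extra(3))
    ultimately show ?thesis using X(2) by (simp add: card_subset_eq)
  qed
  have powR: "(z ^ k) ^ ?n = 1" if "z ^ ?n = 1" for z :: 'a and k
    using that by (metis mult.commute power_mult power_one)
  have genS: "generate ?G {diag2 z z} = S" if "diag2 z z \<in> D2" "D.ord (diag2 z z) = ?n" for z
  proof (rule gen_eq[OF that])
    have "diag2 z z [^]\<^bsub>?G\<^esub> ?n = diag2 1 1" using D.pow_eq_id[of "diag2 z z" ?n] that by simp
    then show "diag2 z z [^]\<^bsub>?G\<^esub> k \<in> S" for k :: nat using powR by (auto simp: S_def)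
  qed (rule cardS)
  have genT: "generate ?G {diag2 z (inverse z)} = T"
    if "diag2 z (inverse z) \<in> D2" "D.ord (diag2 z (inverse z)) = ?n" for z
  proof (rule gen_eq[OF that])
    have "diag2 z (inverse z) [^]\<^bsub>?G\<^esub> ?n = diag2 1 1"
      using D.pow_eq_id[of "diag2 z (inverse z)" ?n] that by simp
    then show "diag2 z (inverse z) [^]\<^bsub>?G\<^esub> k \<in> T" for k :: nat
      using powR by (auto simp: T_def power_inverse)
  qed (rule cardS)
  have aS: "diag2 a a \<in> D2" "D.ord (diag2 a a) = ?n"
    using a a0 by (auto simp: mem_D2_iff intro!: ordn)
  have aT: "diag2 a (inverse a) \<in> D2" "D.ord (diag2 a (inverse a)) = ?n"
    using a a0 by (auto simp: mem_D2_iff power_inverse intro!: ordn)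
  have "S \<in> fixed_iso_subgroups ?G id P" "T \<in> fixed_iso_subgroups ?G id P"
    unfolding Fid using genS[OF aS] genT[OF aT] aS aT by blast+
  moreover have "swap_diag ` S = S" by (auto simp: S_def image_image)
  moreover have "swap_diag ` T = T"
  proof -
    have "(\<lambda>z::'a. diag2 (inverse z) z) ` ?R = (\<lambda>z. diag2 z (inverse z)) ` (inverse ` ?R)"
      by (simp add: image_image)
    moreover have "inverse ` ?R = ?R"
    proof
      show "inverse ` ?R \<subseteq> ?R" by (auto simp: power_inverse)
      show "?R \<subseteq> inverse ` ?R"
      proof
        fix z assume "z \<in> ?R"
        then have "inverse z \<in> ?R" by (simp add: power_inverse)
        then show "z \<in> inverse ` ?R" by (metis imageI inverse_inverse_eq)
      qed
    qed
    ultimately show ?thesis by (simp add: T_def image_image)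
  qed
  ultimately have sub: "{S, T} \<subseteq> fixed_iso_subgroups ?G swap_diag P"
    by (auto simp: fixed_iso_subgroups_def)
  have "K \<in> {S, T}" if "K \<in> fixed_iso_subgroups ?G swap_diag P" for K
  proof -
    have "K \<in> fixed_iso_subgroups ?G id P" and swK: "swap_diag ` K = K"
      using that by (auto simp: fixed_iso_subgroups_def)
    then obtain A where A: "A \<in> D2" "D.ord A = ?n" "K = generate ?G {A}" unfolding Fid by blast
    then obtain x y where xy: "A = diag2 x y" "x \<noteq> 0" "y \<noteq> 0" by (auto simp: mem_D2_iff)
    have "A \<in> K" using A(3) by (simp add: generate.incl)
    then have "diag2 y x \<in> generate ?G {A}"
      unfolding A(3)[symmetric] using swK xy(1) by (metis image_eqI swap_diag_diag2)
    then have "\<exists>t::nat. diag2 y x = A [^]\<^bsub>?G\<^esub> t"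
      using D.generate_pow_nat[of A] A(1,2) n by simp
    then obtain t where "diag2 y x = A [^]\<^bsub>?G\<^esub> (t::nat)"
      by (elim exE)
    then have "diag2 y x = diag2 (x ^ t) (y ^ t)" unfolding xy(1) diag2_pow .
    then have t: "y = x ^ t" "x = y ^ t" unfolding mat2_eq_iff by blast+
    have tn: "D.ord A dvd k" if "x ^ k = 1" for k
    proof -
      have "y ^ k = 1" using that t(1) by (metis mult.commute power_mult power_one)
      then show ?thesis using D.pow_eq_id[of A k] A that xy by simp
    qed
    have xn: "x ^ ?n = 1" using D.pow_eq_id[of A ?n] A xy by auto
    show ?thesis
    proof (cases "t = 0")
      case True
      then have "x = y" using t by (metis power_0)
      then show ?thesis using genS[of x] A xy by simp
    next
      case False
      obtain u where u: "t = Suc u" using False by (cases t) auto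
      have "x * x ^ ((t - 1) * (t + 1)) = x ^ (t * t)"
        unfolding u by (simp flip: power_Suc add: algebra_simps)
      also have "\<dots> = x" using t by (metis power_mult)
      finally have "x ^ ((t - 1) * (t + 1)) = 1" using xy by simp
      then have "?n dvd (t - 1) * (t + 1)" using tn A by metis
      then have "?n dvd t - 1 \<or> ?n dvd t + 1"
        using dvd_pred_mult_succ_cases[OF l(1,4)] False by blast
      then show ?thesis
      proof
        assume "?n dvd t - 1"
        then have "x ^ u = 1" using xn u by (auto elim!: dvdE simp: power_mult)
        then have "y = x" using t(1) u by simp
        then show ?thesis using genS[of x] A xy by simp
      next
        assume "?n dvd t + 1"
        then have "x ^ (t + 1) = 1" using xn by (auto elim!: dvdE simp: power_mult simp del: power_Suc)
        then have "x * y = 1" using t(1) by simp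
        then have "y = inverse x" by (simp add: inverse_unique)
        then show ?thesis using genT[of x] A xy by simp
      qed
    qed
  qed
  then have "fixed_iso_subgroups ?G swap_diag P = {S, T}" using sub by blast
  moreover have "S = T \<longleftrightarrow> ?n = 2"
  proof
    assume "S = T"
    then have "diag2 a a \<in> T" using a by (auto simp: S_def)
    then have "inverse a = a" by (auto simp: T_def)
    then have "a * a = 1" using right_inverse[OF a0] by simp
    then have "diag2 a a [^]\<^bsub>?G\<^esub> (2::nat) = diag2 1 1" by (simp add: power2_eq_square)
    then have "?n dvd 2" using aS D.pow_eq_id[of "diag2 a a" 2] by simp
    moreover have "?n \<noteq> 1" using l1 l(3) by simp
    ultimately show "?n = 2" by (metis primes_dvd_imp_eq prime_nat_iff two_is_prime_nat)
  next
    assume n2: "?n = 2"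
    have "inverse z = z" if "z \<in> ?R" for z
      using that unfolding n2 by (simp add: power2_eq_square inverse_unique)
    then show "S = T" unfolding S_def T_def by (intro image_cong) auto
  qed
  ultimately show ?thesis by (cases "?n = 2") (simp_all add: card_insert_if)
qed

section \<open>Conjugacy classes of reducible subgroups\<close>

text \<open>Each fibre of \<open>f\<close> is an orbit \<open>{K, \<tau> K}\<close>, consisting of one fixed point or of two points that are
not fixed. Counting fixed points twice thus contributes 2 for every fibre.\<close>
lemma card_image_involution:
  assumes fin: "finite T" and inv: "\<And>K. K \<in> T \<Longrightarrow> \<tau> K \<in> T"
    and f: "\<And>K K'. K \<in> T \<Longrightarrow> K' \<in> T \<Longrightarrow> f K = f K' \<longleftrightarrow> K' = K \<or> K' = \<tau> K"
  shows "2 * card (f ` T) = card T + card {K \<in> T. \<tau> K = K}"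
proof -
  let ?F = "{K \<in> T. \<tau> K = K}"
  have fib: "card {K \<in> T. f K = y} + card {K \<in> ?F. f K = y} = 2" if y: "y \<in> f ` T" for y
  proof -
    obtain K where K: "K \<in> T" "y = f K" using y by blast
    have T: "{L \<in> T. f L = y} = {K, \<tau> K}"
    proof -
      have "f L = y \<longleftrightarrow> L = K \<or> L = \<tau> K" if "L \<in> T" for L
        unfolding K(2) using f[OF K(1) that] by metis
      then show ?thesis using K(1) inv[OF K(1)] by auto
    qed
    have tt: "\<tau> (\<tau> K) = K \<or> \<tau> K = K"
      using f[OF inv[OF K(1)] K(1)] f[OF K(1) inv[OF K(1)]] by auto
    show ?thesis
    proof (cases "\<tau> K = K")
      case True
      then have "{L \<in> ?F. f L = y} = {K}" using T by auto
      then show ?thesis using T True by simp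
    next
      case False
      have "{L \<in> ?F. f L = y} = {}" using T tt False by auto
      then have "card {L \<in> ?F. f L = y} = 0" by (metis card.empty)
      then show ?thesis using T False by simp
    qed
  qed
  have "card T + card ?F = (\<Sum>y\<in>f ` T. card {K \<in> T. f K = y}) + (\<Sum>y\<in>f ` T. card {K \<in> ?F. f K = y})"
    using sum.group[of T "f ` T" f "\<lambda>_. 1::nat"] sum.group[of ?F "f ` T" f "\<lambda>_. 1::nat"] fin
    by (simp add: image_mono)
  also have "\<dots> = (\<Sum>y\<in>f ` T. 2)"
    using fib by (simp flip: sum.distrib)
  finally show ?thesis by simp
qed

definition conjugate :: "('g, 'x) monoid_scheme \<Rightarrow> 'g \<Rightarrow> 'g \<Rightarrow> 'g" where
  "conjugate G g x = g \<otimes>\<^bsub>G\<^esub> x \<otimes>\<^bsub>G\<^esub> inv\<^bsub>G\<^esub> g"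

lemma subgroup_conj_class_eq:
  "subgroup_conj_class G K = (\<lambda>g. conjugate G g ` K) ` carrier G"
  by (auto simp: subgroup_conj_class_def conjugate_def l_coset_def r_coset_def image_def)

context group begin

lemma conjugate_closed [simp]:
  "g \<in> carrier G \<Longrightarrow> x \<in> carrier G \<Longrightarrow> conjugate G g x \<in> carrier G"
  by (simp add: conjugate_def)

lemma conjugate_conjugate:
  assumes "g \<in> carrier G" "h \<in> carrier G" "x \<in> carrier G"
  shows "conjugate G h (conjugate G g x) = conjugate G (h \<otimes> g) x"
  using assms by (simp add: conjugate_def inv_mult_group m_assoc)

lemma conjugate_one: "x \<in> carrier G \<Longrightarrow> conjugate G \<one> x = x"
  by (simp add: conjugate_def)

lemma conjugate_eq_iff:
  assumes "g \<in> carrier G" "x \<in> carrier G" "y \<in> carrier G"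
  shows "conjugate G g x = y \<longleftrightarrow> g \<otimes> x = y \<otimes> g"
  using assms unfolding conjugate_def by (metis inv_solve_right m_closed)

lemma conjugate_iso:
  assumes g: "g \<in> carrier G"
  shows "conjugate G g \<in> iso G G"
proof -
  have "conjugate G g (x \<otimes> y) = conjugate G g x \<otimes> conjugate G g y"
    if "x \<in> carrier G" "y \<in> carrier G" for x y
  proof -
    have "inv g \<otimes> (g \<otimes> z) = z" if "z \<in> carrier G" for z
      using g that by (simp flip: m_assoc)
    then show ?thesis using g that by (simp add: conjugate_def m_assoc)
  qed
  moreover have "bij_betw (conjugate G g) (carrier G) (carrier G)"
    by (rule bij_betw_byWitness[where f' = "conjugate G (inv g)"])
      (use g in \<open>auto simp: conjugate_conjugate conjugate_one\<close>)
  ultimately show ?thesis using g by (auto simp: iso_def hom_def)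
qed

lemma subgroup_conj_class_conjugate:
  assumes g: "g \<in> carrier G" and K: "K \<subseteq> carrier G"
  shows "subgroup_conj_class G (conjugate G g ` K) = subgroup_conj_class G K"
proof -
  have c: "conjugate G h ` conjugate G g ` K = conjugate G (h \<otimes> g) ` K" if "h \<in> carrier G" for h
    unfolding image_image using that g K by (intro image_cong) (auto simp: conjugate_conjugate)
  have c': "conjugate G h ` K = conjugate G (h \<otimes> inv g) ` conjugate G g ` K" if "h \<in> carrier G" for h
    using c[of "h \<otimes> inv g"] that g by (simp add: m_assoc)
  show ?thesis
    unfolding subgroup_conj_class_eq
  proof (intro equalityI subsetI; elim imageE)
    fix L h assume "L = conjugate G h ` conjugate G g ` K" "h \<in> carrier G"
    then show "L \<in> (\<lambda>g. conjugate G g ` K) ` carrier G"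
      using c[of h] g by (intro image_eqI[of _ _ "h \<otimes> g"]) simp_all
  next
    fix L h assume "L = conjugate G h ` K" "h \<in> carrier G"
    then show "L \<in> (\<lambda>h. conjugate G h ` conjugate G g ` K) ` carrier G"
      using c'[of h] g by (intro image_eqI[of _ _ "h \<otimes> inv g"]) simp_all
  qed
qed

lemma mem_subgroup_conj_class:
  assumes "K \<subseteq> carrier G"
  shows "K \<in> subgroup_conj_class G K"
proof -
  have "conjugate G \<one> ` K = (\<lambda>x. x) ` K"
    using assms by (intro image_cong) (auto simp: conjugate_one)
  then show ?thesis unfolding subgroup_conj_class_eq by (intro image_eqI[of _ _ \<one>]) simp_all
qed

lemma conjugate_subgroup:
  assumes g: "g \<in> carrier G" and K: "subgroup K G"
  shows "subgroup (conjugate G g ` K) G" "card (conjugate G g ` K) = card K"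
    "G\<lparr>carrier := K\<rparr> \<cong> G\<lparr>carrier := conjugate G g ` K\<rparr>"
proof -
  note iso = conjugate_iso[OF g]
  show "subgroup (conjugate G g ` K) G"
    using subgroup.iso_subgroup[OF K is_group is_group iso] .
  show i: "G\<lparr>carrier := K\<rparr> \<cong> G\<lparr>carrier := conjugate G g ` K\<rparr>"
    using iso_restrict[OF iso is_group is_group K] by (rule is_isoI)
  show "card (conjugate G g ` K) = card K" using iso_same_card[OF i] by simp
qed

end

lemma reducible_subgroup_common_eigenvector:
  fixes K :: "('a::field ^ 2 ^ 2) set"
  assumes "reducible_subgroup K"
  obtains v where "v \<noteq> 0" "\<And>A. A \<in> K \<Longrightarrow> \<exists>c. A *v v = c *s v"
proof -
  obtain W :: "('a ^ 2) set" where W: "vec.subspace W" "vec.dim W = 1"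
    "\<And>A. A \<in> K \<Longrightarrow> (*v) A ` W \<subseteq> W"
    using assms unfolding reducible_subgroup_def by blast
  have "\<not> W \<subseteq> {0}" using W(2) by (metis vec.dim_eq_0 zero_neq_one)
  then obtain v where v: "v \<in> W" "v \<noteq> 0" by blast
  have "vec.independent {v}" using v by simp
  then have "W \<subseteq> vec.span {v}"
    using vec.card_ge_dim_independent[of "{v}" W] v W(2) by simp
  then have "\<exists>c. w = c *s v" if "w \<in> W" for w
    using that by (auto simp: vec.span_singleton)
  then show ?thesis using that[of v] v W(3) by blast
qed

text \<open>Take the common eigenvector as the first vector of a new basis.\<close>
lemma reducible_subgroup_conj_upper:
  fixes K :: "('a::field ^ 2 ^ 2) set"
  assumes red: "reducible_subgroup K"
  obtains g where "g \<in> carrier GL2" "\<And>A. A \<in> K \<Longrightarrow> \<exists>a b d. conjugate GL2 g A = mat2 a b 0 d"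
proof -
  interpret group "GL2 :: ('a ^ 2 ^ 2) monoid" by (rule group_GL2)
  have KG: "A \<in> carrier GL2" if "A \<in> K" for A
    using red that by (auto simp: reducible_subgroup_def dest: subgroup.mem_carrier)
  obtain v where v: "v \<noteq> 0" "\<And>A. A \<in> K \<Longrightarrow> \<exists>c. A *v v = c *s v"
    using reducible_subgroup_common_eigenvector[OF red] by blast
  define h where "h = (if v $ 1 \<noteq> 0 then mat2 (v $ 1) 0 (v $ 2) 1 else mat2 0 1 (v $ 2) 0)"
  have v12: "v $ 1 \<noteq> 0 \<or> v $ 2 \<noteq> 0" using v(1) by (auto simp: vec_eq_iff forall_2)
  then have h: "h \<in> carrier GL2" by (auto simp: h_def)
  show ?thesis
  proof (rule that[of "inv\<^bsub>GL2\<^esub> h"])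
    show "inv\<^bsub>GL2\<^esub> h \<in> carrier GL2" using h by simp
    fix A assume A: "A \<in> K"
    obtain c where c: "A *v v = c *s v" using v(2)[OF A] by blast
    obtain p q r s where A': "A = mat2 p q r s" by (rule mat2_cases)
    define B where "B = conjugate GL2 (inv\<^bsub>GL2\<^esub> h) A"
    obtain a b c' d where B': "B = mat2 a b c' d" by (rule mat2_cases)
    have "conjugate GL2 h B = A"
      unfolding B_def using h KG[OF A] by (simp add: conjugate_conjugate conjugate_one del: GL2_simps)
    then have "h ** B = A ** h"
      using conjugate_eq_iff[of h B A] h KG[OF A] by (simp add: B_def)
    moreover have "p * v $ 1 + q * v $ 2 = c * v $ 1" "r * v $ 1 + s * v $ 2 = c * v $ 2"
      using arg_cong[OF c, of "\<lambda>w. w $ 1"] arg_cong[OF c, of "\<lambda>w. w $ 2"]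
      by (simp_all add: A' matrix_vector_mult_def sum_2)
    ultimately have "c' = 0"
      using v12 unfolding h_def A' B' by (auto split: if_splits simp: algebra_simps)
    then show "\<exists>a b d. conjugate GL2 (inv\<^bsub>GL2\<^esub> h) A = mat2 a b 0 d"
      using B' by (auto simp: B_def)
  qed
qed

lemma upper_pow:
  fixes a b :: "'a::field"
  shows "mat2 a b 0 a [^]\<^bsub>GL2\<^esub> n = mat2 (a ^ n) (of_nat n * a ^ (n - 1) * b) 0 (a ^ n)"
proof (induction n)
  case (Suc n)
  then show ?case by (cases n) (auto simp: nat_pow_def algebra_simps)
qed (simp add: nat_pow_def)

text \<open>First make the group upper triangular. If every element has equal diagonal entries, its power with
exponent \<open>card K\<close> shows that the entry above the diagonal vanishes, as \<open>card K\<close> is invertible in the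
field. Otherwise some element has distinct eigenvalues; diagonalizing it diagonalizes everything that
commutes with it.\<close>
lemma reducible_abelian_conj_diagonal:
  fixes K :: "('a::field ^ 2 ^ 2) set"
  assumes red: "reducible_subgroup K"
    and comm: "\<And>A B. A \<in> K \<Longrightarrow> B \<in> K \<Longrightarrow> A ** B = B ** A"
    and char: "of_nat (card K) \<noteq> (0 :: 'a)"
  obtains g where "g \<in> carrier GL2" "conjugate GL2 g ` K \<subseteq> D2"
proof -
  interpret group "GL2 :: ('a ^ 2 ^ 2) monoid" by (rule group_GL2)
  have K: "subgroup K GL2" using red by (simp add: reducible_subgroup_def)
  obtain g where g: "g \<in> carrier GL2" "\<And>A. A \<in> K \<Longrightarrow> \<exists>a b d. conjugate GL2 g A = mat2 a b 0 d"
    using reducible_subgroup_conj_upper[OF red] by blast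
  define L where "L = conjugate GL2 g ` K"
  have L: "subgroup L GL2" "card L = card K"
    unfolding L_def using conjugate_subgroup[OF g(1) K] by auto
  have LG: "A \<in> carrier GL2" if "A \<in> L" for A using subgroup.mem_carrier[OF L(1) that] .
  have up: "\<exists>a b d. A = mat2 a b 0 d" if "A \<in> L" for A using that g(2) by (auto simp: L_def)
  have commL: "A ** B = B ** A" if AB: "A \<in> L" "B \<in> L" for A B
  proof -
    obtain A' B' where A'B': "A' \<in> K" "B' \<in> K" "A = conjugate GL2 g A'" "B = conjugate GL2 g B'"
      using AB by (auto simp: L_def)
    have hom: "conjugate GL2 g (X ** Y) = conjugate GL2 g X ** conjugate GL2 g Y"
      if "X \<in> K" "Y \<in> K" for X Y
      using conjugate_iso[OF g(1)] that subgroup.mem_carrier[OF K] by (auto simp: iso_def hom_def)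
    show ?thesis using hom[OF A'B'(1,2)] hom[OF A'B'(2,1)] comm[OF A'B'(1,2)] A'B'(3,4) by simp
  qed
  show ?thesis
  proof (cases "\<forall>A\<in>L. A $ 1 $ 1 = A $ 2 $ 2")
    case True
    have "A \<in> D2" if A: "A \<in> L" for A
    proof -
      obtain a b where ab: "A = mat2 a b 0 a" using up[OF A] True A by fastforce
      have a0: "a \<noteq> 0" using LG[OF A] ab by simp
      have "A [^]\<^bsub>GL2\<^esub> card K = diag2 1 1" using pow_card_subgroup[OF L(1) A] L(2) by simp
      then have "of_nat (card K) * a ^ (card K - 1) * b = 0" using upper_pow[of a b] ab by simp
      then show ?thesis using char a0 ab by (auto simp: mem_D2_iff)
    qed
    then show ?thesis using that[OF g(1)] by (auto simp: L_def)
  next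
    case False
    then obtain A where A: "A \<in> L" "A $ 1 $ 1 \<noteq> A $ 2 $ 2" by blast
    then obtain a b d where abd: "A = mat2 a b 0 d" "a \<noteq> d" using up[OF A(1)] by fastforce
    have nz: "a \<noteq> 0" "d \<noteq> 0" using LG[OF A(1)] abd by auto
    \<comment> \<open>The unipotent matrix that conjugates \<open>A\<close> to \<open>diag2 a d\<close>.\<close>
    define h where "h = mat2 1 (b / (a - d)) 0 1"
    have h: "h \<in> carrier GL2" by (simp add: h_def)
    have "conjugate GL2 (h ** g) X \<in> D2" if X: "X \<in> K" for X
    proof -
      have XL: "conjugate GL2 g X \<in> L" using X by (simp add: L_def)
      obtain x y z where xyz: "conjugate GL2 g X = mat2 x y 0 z" using up[OF XL] by blast
      have xz: "x \<noteq> 0" "z \<noteq> 0" using LG[OF XL] xyz by auto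
      have "a * y + b * z = x * b + y * d" using commL[OF A(1) XL] unfolding xyz abd by simp
      then have "y + b / (a - d) * z = x * (b / (a - d))"
        using abd(2) by (simp add: field_simps)
      then have "conjugate GL2 h (mat2 x y 0 z) = diag2 x z"
        using conjugate_eq_iff[of h "mat2 x y 0 z" "diag2 x z"] h xz by (simp add: h_def)
      then show ?thesis
        using conjugate_conjugate[OF g(1) h subgroup.mem_carrier[OF K X]] xyz xz by (metis mem_D2_iff GL2_simps(1))
    qed
    then show ?thesis using that[of "h ** g"] m_closed[OF h g(1)] by auto
  qed
qed

text \<open>If \<open>K\<close> consists of scalar matrices, conjugation does nothing. Otherwise \<open>K\<close> contains a diagonal
matrix with distinct entries, and \<open>g\<close> has to preserve or interchange its two eigenlines, so it is
diagonal or antidiagonal.\<close>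
lemma D2_conjugate_cases:
  fixes K :: "('a::field ^ 2 ^ 2) set"
  assumes K: "K \<subseteq> D2" and g: "g \<in> carrier GL2" and gK: "conjugate GL2 g ` K \<subseteq> D2"
  shows "conjugate GL2 g ` K = K \<or> conjugate GL2 g ` K = swap_diag ` K"
proof -
  interpret group "GL2 :: ('a ^ 2 ^ 2) monoid" by (rule group_GL2)
  obtain p q r s where pq: "g = mat2 p q r s" by (rule mat2_cases)
  have det: "p * s - q * r \<noteq> 0" using g pq by simp
  have cj: "conjugate GL2 g A = B" if "A \<in> D2" "B \<in> D2" "g ** A = B ** g" for A B
    using conjugate_eq_iff[OF g, of A B] that subgroup.mem_carrier[OF subgroup_D2 that(1)]
      subgroup.mem_carrier[OF subgroup_D2 that(2)] by simp
  show ?thesis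
  proof (cases "\<exists>a d. diag2 a d \<in> K \<and> a \<noteq> d")
    case False
    have "conjugate GL2 g A = A" if A: "A \<in> K" for A
    proof -
      have AD: "A \<in> D2" using A K by blast
      then obtain a d where ad: "A = diag2 a d" using mem_D2_iff by blast
      then have "a = d" using False A by blast
      then have "g ** A = A ** g" unfolding ad pq by (simp add: mult.commute)
      then show ?thesis by (rule cj[OF AD AD])
    qed
    then show ?thesis by simp
  next
    case True
    then obtain a d where ad: "diag2 a d \<in> K" "a \<noteq> d" by blast
    have "conjugate GL2 g (diag2 a d) \<in> D2" using gK ad(1) by blast
    then obtain a' d' where ad': "conjugate GL2 g (diag2 a d) = diag2 a' d'"
      using mem_D2_iff by blast
    have "diag2 a d \<in> D2" "diag2 a' d' \<in> D2"
      using ad(1) K gK unfolding ad'[symmetric] by blast+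
    then have "g ** diag2 a d = diag2 a' d' ** g"
      using conjugate_eq_iff[OF g, of "diag2 a d" "diag2 a' d'"] ad'
        subgroup.mem_carrier[OF subgroup_D2] by (metis GL2_simps(1))
    then have eq: "p * a = a' * p" "q * d = a' * q" "r * a = d' * r" "s * d = d' * s"
      by (simp_all add: pq)
    have "q = 0 \<and> r = 0 \<or> p = 0 \<and> s = 0"
    proof (cases "p = 0")
      case True
      then have "q \<noteq> 0" "r \<noteq> 0" using det by auto
      then show ?thesis using eq ad(2) True by auto
    next
      case False
      then have "q = 0" using eq(1,2) ad(2) by auto
      then have "s \<noteq> 0" using det by auto
      then show ?thesis using eq(3,4) ad(2) \<open>q = 0\<close> by auto
    qed
    then show ?thesis
    proof
      assume qr: "q = 0 \<and> r = 0"
      have "conjugate GL2 g A = A" if A: "A \<in> K" for A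
      proof -
        have AD: "A \<in> D2" using A K by blast
        then obtain x y where "A = diag2 x y" using mem_D2_iff by blast
        then have "g ** A = A ** g" using qr by (simp add: pq mult.commute)
        then show ?thesis by (rule cj[OF AD AD])
      qed
      then show ?thesis by simp
    next
      assume ps: "p = 0 \<and> s = 0"
      have "conjugate GL2 g A = swap_diag A" if A: "A \<in> K" for A
      proof -
        have AD: "A \<in> D2" using A K by blast
        then obtain x y where xy: "A = diag2 x y" "x \<noteq> 0" "y \<noteq> 0" using mem_D2_iff by blast
        then have "swap_diag A \<in> D2" by (auto simp: mem_D2_iff)
        moreover have "g ** A = swap_diag A ** g" using xy ps by (simp add: pq mult.commute)
        ultimately show ?thesis by (rule cj[OF AD])
      qed
      then show ?thesis by simp
    qed
  qed
qed

lemma swap_diag_eq_conjugate: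
  assumes "A \<in> (D2 :: ('a::field ^ 2 ^ 2) set)"
  shows "swap_diag A = conjugate GL2 (mat2 0 1 1 0) A"
proof -
  interpret group "GL2 :: ('a ^ 2 ^ 2) monoid" by (rule group_GL2)
  obtain a d where "A = diag2 a d" "a \<noteq> 0" "d \<noteq> 0" using assms by (auto simp: mem_D2_iff)
  then show ?thesis
    using conjugate_eq_iff[of "mat2 0 1 1 0" A "swap_diag A"] by simp
qed

lemma subgroup_D2_reducible:
  assumes "subgroup K (GL2 :: ('a::field ^ 2 ^ 2) monoid)" "K \<subseteq> D2"
  shows "reducible_subgroup K"
proof -
  let ?e = "vector [1, 0] :: 'a ^ 2"
  have "?e \<noteq> 0" by (simp add: vec_eq_iff forall_2)
  then have "vec.dim (vec.span {?e}) = 1" by simp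
  moreover have "(*v) A ` vec.span {?e} \<subseteq> vec.span {?e}" if A: "A \<in> K" for A
  proof -
    have "A \<in> D2" using A assms(2) by blast
    then obtain a d where ad: "A = diag2 a d" by (auto simp: mem_D2_iff)
    have "A *v (c *s ?e) = (a * c) *s ?e" for c
      by (simp add: ad vec_eq_iff forall_2 matrix_vector_mult_def sum_2)
    then show ?thesis by (auto simp: vec.span_singleton)
  qed
  ultimately show ?thesis
    using assms(1) vec.subspace_span unfolding reducible_subgroup_def by blast
qed

text \<open>Every class counted by \<open>N_red\<close> meets the subgroups of \<open>D2\<close>, and two of these are conjugate exactly
when they are equal or swapped. So the classes are the orbits of the swap on the subgroups of \<open>D2\<close>
isomorphic to \<open>H\<close>.\<close>
lemma N_red_eq_swap_orbits:
  fixes H :: "('a::{field,finite} ^ 2 ^ 2) set"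
  assumes H: "subgroup H diag_group" and char: "of_nat (card H) \<noteq> (0 :: 'a)"
  shows "2 * N_red (card H) H =
    card (fixed_iso_subgroups diag_group id H) + card (fixed_iso_subgroups diag_group swap_diag H)"
proof -
  interpret group "GL2 :: ('a ^ 2 ^ 2) monoid" by (rule group_GL2)
  interpret D: comm_group "diag_group :: ('a ^ 2 ^ 2) monoid" by (rule comm_group_diag_group)
  let ?G = "GL2 :: ('a ^ 2 ^ 2) monoid" and ?f = "subgroup_conj_class (GL2 :: ('a ^ 2 ^ 2) monoid)"
  define S where "S = {K. reducible_subgroup K \<and> card K = card H \<and> ?G\<lparr>carrier := K\<rparr> \<cong> ?G\<lparr>carrier := H\<rparr>}"
  define T where "T = fixed_iso_subgroups diag_group id H"
  have T_iff: "K \<in> T \<longleftrightarrow> subgroup K ?G \<and> K \<subseteq> D2 \<and> ?G\<lparr>carrier := K\<rparr> \<cong> ?G\<lparr>carrier := H\<rparr>" for K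
    by (auto simp: T_def fixed_iso_subgroups_def subgroup_diag_group_iff)
  have HG: "subgroup H ?G" "H \<subseteq> D2" using H subgroup_diag_group_iff by auto
  have TS: "T \<subseteq> S"
    using subgroup_D2_reducible iso_same_card by (fastforce simp: T_iff S_def)
  have "\<exists>L\<in>T. ?f L = ?f K" if "K \<in> S" for K
  proof -
    have K: "reducible_subgroup K" "subgroup K ?G" "card K = card H" "?G\<lparr>carrier := K\<rparr> \<cong> ?G\<lparr>carrier := H\<rparr>"
      using that by (auto simp: S_def reducible_subgroup_def)
    have "comm_group (?G\<lparr>carrier := H\<rparr>)"
    proof (rule group.group_comm_groupI[OF subgroup_imp_group[OF HG(1)]])
      fix A B assume "A \<in> carrier (?G\<lparr>carrier := H\<rparr>)" "B \<in> carrier (?G\<lparr>carrier := H\<rparr>)"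
      then show "A \<otimes>\<^bsub>?G\<lparr>carrier := H\<rparr>\<^esub> B = B \<otimes>\<^bsub>?G\<lparr>carrier := H\<rparr>\<^esub> A"
        using D.m_comm[of A B] HG(2) by (simp add: subset_iff)
    qed
    then interpret K: comm_group "?G\<lparr>carrier := K\<rparr>"
      using comm_group.iso_imp_comm_group[OF _ group.iso_sym[OF subgroup_imp_group[OF K(2)] K(4)]]
        subgroup_imp_group[OF K(2)] group.is_monoid by blast
    have "A ** B = B ** A" if "A \<in> K" "B \<in> K" for A B
      using K.m_comm[of A B] that by simp
    then obtain g where g: "g \<in> carrier ?G" "conjugate ?G g ` K \<subseteq> D2"
      using reducible_abelian_conj_diagonal[OF K(1)] K(3) char by metis
    have "conjugate ?G g ` K \<in> T"
      unfolding T_iff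
      using conjugate_subgroup[OF g(1) K(2)] g(2) K(4) iso_trans
        group.iso_sym[OF subgroup_imp_group[OF K(2)]] by blast
    then show ?thesis
      using subgroup_conj_class_conjugate[OF g(1) subgroup.subset[OF K(2)]] by blast
  qed
  then have "?f ` S = ?f ` T" using TS by (metis (no_types, lifting) image_eqI image_mono image_subsetI subset_antisym)
  then have N: "N_red (card H) H = card (?f ` T)"
    by (simp add: N_red_def S_def)
  have sw: "swap_diag ` K = conjugate ?G (mat2 0 1 1 0) ` K" if "K \<in> T" for K
    using that swap_diag_eq_conjugate by (intro image_cong) (auto simp: T_iff)
  have w: "mat2 0 1 1 0 \<in> carrier ?G" by simp
  have "2 * card (?f ` T) = card T + card {K \<in> T. swap_diag ` K = K}"
  proof (rule card_image_involution)
    show "finite T" by simp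
  next
    fix K assume K: "K \<in> T"
    have "swap_diag A \<in> D2" if "A \<in> D2" for A :: "'a ^ 2 ^ 2"
      using that by (auto simp: mem_D2_iff)
    then have "swap_diag ` K \<subseteq> D2" using K by (auto simp: T_iff)
    moreover have KG: "subgroup K ?G" and KH: "?G\<lparr>carrier := K\<rparr> \<cong> ?G\<lparr>carrier := H\<rparr>"
      using K by (auto simp: T_iff)
    have "?G\<lparr>carrier := swap_diag ` K\<rparr> \<cong> ?G\<lparr>carrier := H\<rparr>"
      unfolding sw[OF K]
      by (rule iso_trans[OF group.iso_sym[OF subgroup_imp_group[OF KG] conjugate_subgroup(3)[OF w KG]] KH])
    moreover have "subgroup (swap_diag ` K) ?G"
      unfolding sw[OF K] by (rule conjugate_subgroup(1)[OF w KG])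
    ultimately show "swap_diag ` K \<in> T" unfolding T_iff by blast
  next
    fix K K' assume K: "K \<in> T" "K' \<in> T"
    have KG: "K \<subseteq> carrier ?G" "K' \<subseteq> carrier ?G"
      using K subgroup.subset by (auto simp: T_iff)
    show "?f K = ?f K' \<longleftrightarrow> K' = K \<or> K' = swap_diag ` K"
    proof
      assume "?f K = ?f K'"
      then have "K' \<in> ?f K" using mem_subgroup_conj_class[OF KG(2)] by simp
      then obtain g where "g \<in> carrier ?G" "K' = conjugate ?G g ` K"
        unfolding subgroup_conj_class_eq by blast
      then show "K' = K \<or> K' = swap_diag ` K"
        using D2_conjugate_cases[of K g] K by (auto simp: T_iff)
    next
      assume "K' = K \<or> K' = swap_diag ` K"
      then show "?f K = ?f K'"
        using sw[OF K(1)] subgroup_conj_class_conjugate[OF w KG(1)] by auto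
    qed
  qed
  moreover have "{K \<in> T. swap_diag ` K = K} = fixed_iso_subgroups diag_group swap_diag H"
    by (auto simp: T_def fixed_iso_subgroups_def)
  ultimately show ?thesis using N by (simp add: T_def)
qed

text \<open>The characteristic divides the order of the field, so it is a power of \<open>p\<close> other than 1.\<close>
lemma of_nat_neq_0_in_finite_field:
  assumes p: "prime p" "CARD('a::{field,finite}) = p ^ e" and m: "\<not> p dvd m"
  shows "of_nat m \<noteq> (0 :: 'a)"
proof
  assume "of_nat m = (0 :: 'a)"
  then have "CHAR('a) dvd m" by (simp add: of_nat_eq_0_iff_char_dvd)
  moreover have "CHAR('a) dvd p ^ e" using CHAR_dvd_CARD[where ?'a = 'a] p(2) by simp
  then obtain i where i: "CHAR('a) = p ^ i" using divides_primepow_nat[OF p(1)] by blast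
  moreover have "i \<noteq> 0" using i CHAR_not_1'[where ?'a = 'a] by (cases "i = 0") simp_all
  ultimately show False using m by (metis dvd_power dvd_trans gr0I)
qed

section \<open>The number of classes\<close>

lemma cyclic_order_dvd_card_minus_one:
  fixes P :: "('a::{field,finite} ^ 2 ^ 2) set"
  assumes P: "subgroup P diag_group" "cyclic_group (diag_group\<lparr>carrier := P\<rparr>)"
  shows "card P dvd CARD('a) - 1"
proof -
  interpret D: comm_group "diag_group :: ('a ^ 2 ^ 2) monoid" by (rule comm_group_diag_group)
  obtain A where A: "A \<in> P" "D.ord A = card P"
    using D.cyclic_subgroup_finite_iff[OF P(1)] P(2) by auto
  have "A \<in> D2" using D.group_axioms subgroup.mem_carrier[OF P(1) A(1)] by simp
  then show ?thesis
    using D.pow_eq_id[of A "CARD('a) - 1"] diag_group_pow_card_minus_one[of A] A(2) by simp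
qed

lemma card_cyclic_iso_subgroups_diag_group:
  fixes P :: "('a::{field,finite} ^ 2 ^ 2) set"
  assumes P: "subgroup P diag_group" "cyclic_group (diag_group\<lparr>carrier := P\<rparr>)"
    and l: "prime l" "card P = l ^ \<beta>" "\<beta> > 0"
  shows "card (fixed_iso_subgroups diag_group id P) = l ^ \<beta> + l ^ (\<beta> - 1)"
proof -
  interpret D: comm_group "diag_group :: ('a ^ 2 ^ 2) monoid" by (rule comm_group_diag_group)
  have "card (torsion diag_group (l ^ j) (carrier (diag_group :: ('a ^ 2 ^ 2) monoid))) = (l ^ j)\<^sup>2"
    if "j \<le> \<beta>" for j
  proof -
    have "l ^ j dvd CARD('a) - 1"
      using cyclic_order_dvd_card_minus_one[OF P] l(2) le_imp_power_dvd[OF that, of l] dvd_trans by metis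
    then show ?thesis
      using card_torsion_diag_group[of "l ^ j", where ?'a = 'a] card_roots_of_unity[of "l ^ j", where ?'a = 'a]
        prime_gt_0_nat[OF l(1)] by simp
  qed
  then show ?thesis using D.card_fixed_iso_subgroups_cyclic[OF _ P l] by simp
qed

text \<open>The field has at most \<open>l\<close> roots of unity of order dividing \<open>l\<close>, so the \<open>l\<close>-torsion of \<open>D2\<close> has at
most \<open>l\<^sup>2\<close> elements.\<close>
lemma noncyclic_diag_group:
  fixes P :: "('a::{field,finite} ^ 2 ^ 2) set"
  assumes P: "subgroup P diag_group" "\<not> cyclic_group (diag_group\<lparr>carrier := P\<rparr>)"
    and l: "prime l" "card P = l ^ \<beta>" "\<beta> \<le> 2"
  shows "\<beta> = 2" "\<sigma> \<in> iso diag_group diag_group \<Longrightarrow> fixed_iso_subgroups diag_group \<sigma> P = {P}"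
proof -
  interpret D: comm_group "diag_group :: ('a ^ 2 ^ 2) monoid" by (rule comm_group_diag_group)
  have l0: "l > 0" using prime_gt_0_nat[OF l(1)] .
  have tor: "finite (torsion diag_group l (carrier (diag_group :: ('a ^ 2 ^ 2) monoid)))"
    "card (torsion diag_group l (carrier (diag_group :: ('a ^ 2 ^ 2) monoid))) \<le> l\<^sup>2"
    using card_torsion_diag_group[OF l0, where ?'a = 'a] card_roots_of_unity_le[OF l0, where ?'a = 'a]
    by (simp_all add: power_mono)
  show "\<beta> = 2" using D.noncyclic_prime_square_eq_torsion(1)[OF P l tor] .
  show "\<sigma> \<in> iso diag_group diag_group \<Longrightarrow> fixed_iso_subgroups diag_group \<sigma> P = {P}"
    using D.fixed_iso_subgroups_noncyclic[OF _ P l tor] .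
qed

theorem theorem1p2:
  fixes H :: "('a::{field, finite} ^ 2 ^ 2) set"
    and p q e m k r :: nat
    and pr \<beta> :: "nat \<Rightarrow> nat"
    and P :: "nat \<Rightarrow> ('a ^ 2 ^ 2) set"
    and I :: "nat set"
  assumes "prime p" and "e > 0" and "q = p ^ e" and "CARD('a) = q"
    and "subgroup H (GL2\<lparr>carrier := D2\<rparr>)"
    and "card H = m" and "cube_free m" and "\<not> p dvd m"
    and "m = (\<Prod>i\<le>k. pr i ^ \<beta> i)"
    and "pr 0 = 2" and "\<forall>i\<le>k. prime (pr i)" and "inj_on pr {..k}"
    and "\<exists>i\<le>k. \<beta> i > 0"
    and "\<forall>i\<le>k. \<beta> i > 0 \<longrightarrow> sylow_subgroup (pr i) (GL2\<lparr>carrier := H\<rparr>) (P i)"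
    and "I = {i. 0 < i \<and> i \<le> k \<and> \<beta> i > 0 \<and> cyclic_group (GL2\<lparr>carrier := P i\<rparr>)}"
    and "r = card I"
  shows "rat_of_nat (N_red m H) =
    1 / 2 * (rat_of_nat (rho m pr \<beta> I r (GL2\<lparr>carrier := P 0\<rparr>)) +
             rat_of_nat (delta \<beta> r (GL2\<lparr>carrier := P 0\<rparr>)))"
proof -
  let ?D = "diag_group :: ('a ^ 2 ^ 2) monoid"
  interpret D: comm_group ?D by (rule comm_group_diag_group)
  note H = assms(5)
  have pr: "prime (pr i)" "pr i > 1" if "i \<le> k" for i
    using assms(11) that prime_gt_1_nat by auto
  have pr_eq: "pr i = pr j \<longleftrightarrow> i = j" if "i \<le> k" "j \<le> k" for i j
    using assms(12) that by (auto simp: inj_on_def)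
  define n where "n i = pr i ^ \<beta> i" for i
  define C where "C i \<longleftrightarrow> \<beta> i > 0 \<and> cyclic_group (GL2\<lparr>carrier := P i\<rparr>)" for i
  have cop: "coprime (n i) (n j)" if "i \<le> k" "j \<le> k" "i \<noteq> j" for i j
    unfolding n_def using that pr pr_eq[of i j] by (simp add: primes_coprime)
  have card: "card H = (\<Prod>i\<in>{..k}. n i)" using assms(6,9) by (simp add: n_def)
  have m0: "m > 0" using assms(7) by (simp add: cube_free_def)
  have split: "m = n i * (\<Prod>j\<in>{..k} - {i}. n j)" "coprime (n i) (\<Prod>j\<in>{..k} - {i}. n j)"
    if "i \<le> k" for i
  proof -
    show "m = n i * (\<Prod>j\<in>{..k} - {i}. n j)"
      using card assms(6) that prod.remove[of "{..k}" i n] by simp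
    show "coprime (n i) (\<Prod>j\<in>{..k} - {i}. n j)"
      using cop that by (intro prod_coprime_right) auto
  qed
  have b2: "\<beta> i \<le> 2" if "i \<le> k" for i
  proof (rule ccontr)
    assume "\<not> \<beta> i \<le> 2"
    then have "pr i ^ 3 dvd n i" unfolding n_def by (intro le_imp_power_dvd) simp
    then have "pr i ^ 3 dvd m" using split(1)[OF that] by simp
    then show False using assms(7) pr(1)[OF that] by (simp add: cube_free_def)
  qed
  have P: "subgroup (P i) ?D" "P i \<subseteq> H" "card (P i) = n i" if i: "i \<le> k" "\<beta> i > 0" for i
  proof -
    have s: "subgroup (P i) (GL2\<lparr>carrier := H\<rparr>)" "card (P i) = pr i ^ multiplicity (pr i) m"
      using assms(14) i assms(6) by (auto simp: sylow_subgroup_def)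
    show "P i \<subseteq> H" using subgroup.subset[OF s(1)] by simp
    show "subgroup (P i) ?D" using D.incl_subgroup[OF H] s(1) by simp
    have "coprime (pr i) (\<Prod>j\<in>{..k} - {i}. n j)"
      using split(2)[OF i(1)] i(2) by (simp add: n_def)
    then have "\<not> pr i dvd (\<Prod>j\<in>{..k} - {i}. n j)"
      using pr(2)[OF i(1)] by (metis coprime_common_divisor_nat dvd_refl less_irrefl)
    then have "multiplicity (pr i) m = \<beta> i"
      using split(1)[OF i(1)] pr(2)[OF i(1)] unfolding n_def
      by (intro multiplicity_decomposeI) auto
    then show "card (P i) = n i" using s(2) by (simp add: n_def)
  qed
  have tor: "torsion ?D (n i) H = P i" if i: "i \<le> k" "\<beta> i > 0" for i
    by (rule D.subgroup_eq_torsion[OF _ H]) (use split[OF i(1)] P[OF i] assms(6) in auto)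
  \<comment> \<open>For exponent 0 the torsion part is trivial and contributes the factor 1, matching its absence from \<open>I\<close>.\<close>
  have tor0: "fixed_iso_subgroups ?D \<sigma> (torsion ?D (n i) H) = {torsion ?D (n i) H}"
    if "\<beta> i = 0" "\<sigma> \<in> iso ?D ?D" for i \<sigma>
  proof (rule D.fixed_iso_subgroups_card_1[OF that(2) D.subgroup_torsion[OF H]])
    show "card (torsion ?D (n i) H) = 1"
      using D.card_torsion[OF H, of 1 m] assms(6) that(1) by (simp add: n_def)
  qed
  have id: "id \<in> iso ?D ?D" using iso_set_refl by (simp add: id_def)
  \<comment> \<open>A noncyclic Sylow subgroup is elementary abelian of rank 2 and also contributes the factor 1.\<close>
  have noncyc: "\<beta> i = 2" "\<sigma> \<in> iso ?D ?D \<Longrightarrow> fixed_iso_subgroups ?D \<sigma> (P i) = {P i}"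
    if i: "i \<le> k" "\<beta> i > 0" "\<not> C i" for i \<sigma>
  proof -
    have "\<not> cyclic_group (?D\<lparr>carrier := P i\<rparr>)" using i by (simp add: C_def)
    note nc = noncyclic_diag_group[OF P(1)[OF i(1,2)] this pr(1)[OF i(1)] _ b2[OF i(1)]]
    show "\<beta> i = 2" using nc(1) P(3)[OF i(1,2)] by (simp add: n_def)
    show "\<sigma> \<in> iso ?D ?D \<Longrightarrow> fixed_iso_subgroups ?D \<sigma> (P i) = {P i}"
      using nc(2) P(3)[OF i(1,2)] by (simp add: n_def)
  qed
  have f: "card (fixed_iso_subgroups ?D id (torsion ?D (n i) H)) =
      (if C i then pr i ^ \<beta> i + pr i ^ (\<beta> i - 1) else 1)" if i: "i \<le> k" for i
  proof (cases "\<beta> i = 0")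
    case True
    then show ?thesis using tor0[OF _ id] by (simp add: C_def)
  next
    case False
    then have b: "\<beta> i > 0" by simp
    show ?thesis
    proof (cases "C i")
      case True
      then show ?thesis
        using card_cyclic_iso_subgroups_diag_group[OF P(1)[OF i b] _ pr(1)[OF i] _ b] P(3)[OF i b] tor[OF i b]
        by (simp add: C_def n_def)
    next
      case False
      then show ?thesis using noncyc(2)[OF i b _ id] tor[OF i b] by simp
    qed
  qed
  have g: "card (fixed_iso_subgroups ?D swap_diag (torsion ?D (n i) H)) =
      (if C i \<and> n i \<noteq> 2 then 2 else 1)" if i: "i \<le> k" for i
  proof (cases "\<beta> i = 0")
    case True
    then show ?thesis using tor0[OF _ swap_diag_iso] by (simp add: C_def)
  next
    case False
    then have b: "\<beta> i > 0" by simp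
    show ?thesis
    proof (cases "C i")
      case True
      then have c: "cyclic_group (?D\<lparr>carrier := P i\<rparr>)" by (simp add: C_def)
      have cP: "card (P i) = pr i ^ \<beta> i" using P(3)[OF i b] by (simp add: n_def)
      show ?thesis
        using card_swap_fixed_cyclic[OF P(1)[OF i b] c pr(1)[OF i] cP b b2[OF i]]
          cyclic_order_dvd_card_minus_one[OF P(1)[OF i b] c] cP tor[OF i b] True
        by (simp add: n_def)
    next
      case False
      then show ?thesis using noncyc(2)[OF i b _ swap_diag_iso] tor[OF i b] by simp
    qed
  qed
  have I: "I = {i \<in> {1..k}. C i}" using assms(15) by (auto simp: C_def)
  \<comment> \<open>The prime 2 is not indexed by \<open>I\<close>, so its factor is separated from the product.\<close>
  have restrict: "(\<Prod>i\<le>k. if C i then h i else 1) = (if C 0 then h 0 else 1) * (\<Prod>i\<in>I. h i)" for h :: "nat \<Rightarrow> nat"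
  proof -
    have "{..k} = insert 0 {1..k}" by auto
    then have "(\<Prod>i\<le>k. if C i then h i else 1) = (if C 0 then h 0 else 1) * (\<Prod>i\<in>{1..k}. if C i then h i else 1)"
      by simp
    also have "(\<Prod>i\<in>{1..k}. if C i then h i else 1) = (\<Prod>i\<in>I. h i)"
      unfolding I by (rule prod.inter_filter[symmetric]) simp
    finally show ?thesis .
  qed
  have n0: "n 0 = 2 ^ \<beta> 0" using assms(10) by (simp add: n_def)
  \<comment> \<open>Only the prime 2 itself can give the exceptional order 2, and it has index 0.\<close>
  have nI: "n i \<noteq> 2" if "i \<in> I" for i
  proof
    assume n2: "n i = 2"
    have i: "i \<le> k" "i \<noteq> 0" "\<beta> i > 0" using that I by (auto simp: C_def)
    have "pr i dvd 2" using n2 i(3) by (metis dvd_power n_def)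
    then have "pr i = pr 0"
      using pr(1)[OF i(1)] assms(10) by (metis primes_dvd_imp_eq two_is_prime_nat)
    then show False using pr_eq[of i 0] i by simp
  qed
  have F: "card (fixed_iso_subgroups ?D \<sigma> H) = (\<Prod>i\<le>k. card (fixed_iso_subgroups ?D \<sigma> (torsion ?D (n i) H)))"
    if "\<sigma> \<in> iso ?D ?D" for \<sigma>
    by (rule D.card_fixed_iso_subgroups_prod[OF _ that _ _ H card]) (use cop in auto)
  have fid: "card (fixed_iso_subgroups ?D id H) =
      (if C 0 then 2 ^ \<beta> 0 + 2 ^ (\<beta> 0 - 1) else 1) * (\<Prod>i\<in>I. pr i ^ \<beta> i + pr i ^ (\<beta> i - 1))"
    using F[OF id] f restrict[of "\<lambda>i. pr i ^ \<beta> i + pr i ^ (\<beta> i - 1)"] assms(10) by simp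
  have "card (fixed_iso_subgroups ?D swap_diag H) = (\<Prod>i\<le>k. if C i then (if n i \<noteq> 2 then 2 else 1) else 1)"
    unfolding F[OF swap_diag_iso] by (rule prod.cong) (use g in auto)
  also have "\<dots> = (if C 0 then (if n 0 \<noteq> 2 then 2 else 1) else 1) * (\<Prod>i\<in>I. if n i \<noteq> 2 then 2 else 1)"
    by (rule restrict)
  also have "(\<Prod>i\<in>I. if n i \<noteq> 2 then 2 else 1) = 2 ^ r"
    using nI assms(16) by simp
  finally have fsw: "card (fixed_iso_subgroups ?D swap_diag H) =
      (if C 0 then (if n 0 \<noteq> 2 then 2 else 1) else 1) * 2 ^ r" .
  have finI: "finite I" using I by simp
  have even: "even m \<longleftrightarrow> \<beta> 0 > 0"
  proof
    assume "even m"
    show "\<beta> 0 > 0"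
    proof (rule ccontr)
      assume "\<not> \<beta> 0 > 0"
      have "odd (n i)" if "i \<le> k" for i
      proof (cases "i = 0")
        case True
        then show ?thesis using n0 \<open>\<not> \<beta> 0 > 0\<close> by simp
      next
        case False
        then have "pr i \<noteq> 2" using pr_eq[of i 0] that assms(10) by simp
        then have "odd (pr i)" using pr(1)[OF that] prime_odd_nat pr(2)[OF that] by (metis primes_dvd_imp_eq two_is_prime_nat)
        then show ?thesis by (simp add: n_def)
      qed
      then have "odd (\<Prod>i\<in>{..k}. n i)" by (simp add: even_prod_iff)
      then show False using \<open>even m\<close> card assms(6) by simp
    qed
  next
    assume "\<beta> 0 > 0"
    then have "even (n 0)" using n0 by simp
    then show "even m" using split(1)[of 0] by simp
  qed
  have m2: "m \<ge> 2"
  proof -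
    obtain i where i: "i \<le> k" "\<beta> i > 0" using assms(13) by blast
    then have "pr i dvd n i" by (simp add: n_def)
    then have "pr i dvd m" using split(1)[OF i(1)] by simp
    then have "pr i \<le> m" using m0 by (rule dvd_imp_le)
    then show ?thesis using pr(2)[OF i(1)] by simp
  qed
  have I0: "(\<Prod>i\<in>I. pr i ^ \<beta> i + pr i ^ (\<beta> i - 1)) = 1" if "r = 0"
    using that assms(16) finI by simp
  have klein: "GL2\<lparr>carrier := P 0\<rparr> \<cong> klein_four" if "\<beta> 0 > 0" "\<not> C 0"
  proof -
    have "card (P 0) = 4" using P(3)[of 0] noncyc(1)[of 0] that n0 by simp
    then show ?thesis
      using D.noncyclic_order_4_iso_klein_four[of "P 0"] P(1)[of 0] that by (simp add: C_def)
  qed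
  have not_klein: "\<not> GL2\<lparr>carrier := P 0\<rparr> \<cong> klein_four" if "C 0"
  proof
    assume iso: "GL2\<lparr>carrier := P 0\<rparr> \<cong> klein_four"
    have "group (?D\<lparr>carrier := P 0\<rparr>)" using D.subgroup_imp_group P(1)[of 0] that by (simp add: C_def)
    then show False
      using isomorphic_group_cyclicity[OF iso] klein_four_not_cyclic that
      by (simp add: C_def DirProd_group)
  qed
  have Z4: "GL2\<lparr>carrier := P 0\<rparr> \<cong> integer_mod_group 4" if c: "C 0" "\<beta> 0 = 2"
  proof -
    have P0: "subgroup (P 0) ?D" "card (P 0) = 4" using P[of 0] c n0 by (auto simp: C_def)
    obtain x where x: "x \<in> P 0" "P 0 = generate ?D {x}"
      using D.cyclic_subgroup_iff[OF P0(1)] c by (auto simp: C_def)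
    have "x \<in> carrier ?D" using subgroup.mem_carrier[OF P0(1) x(1)] .
    then show ?thesis
      using D.generate_cong_integer_mod_group[of x 4] D.generate_pow_card[of x] x(2) P0(2) by simp
  qed
  have fin0: "0 \<notin> I" using I by simp
  have rho: "rho m pr \<beta> I r (GL2\<lparr>carrier := P 0\<rparr>) = card (fixed_iso_subgroups ?D id H)"
  proof (cases "C 0")
    case True
    then show ?thesis
      using even m2 finI fin0 assms(10) unfolding fid rho_def by (simp add: C_def)
  next
    case False
    then have "\<not> (even m \<and> cyclic_group (GL2\<lparr>carrier := P 0\<rparr>))"
      using even by (simp add: C_def)
    moreover have "m > 2 \<and> odd m \<or> GL2\<lparr>carrier := P 0\<rparr> \<cong> klein_four"
      using klein[OF _ False] even m2 by (cases "m = 2") auto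
    moreover have "\<beta> 0 = 0 \<or> GL2\<lparr>carrier := P 0\<rparr> \<cong> klein_four"
      using klein[OF _ False] by auto
    ultimately show ?thesis
      using False I0 unfolding fid rho_def by auto
  qed
  have delta: "delta \<beta> r (GL2\<lparr>carrier := P 0\<rparr>) = card (fixed_iso_subgroups ?D swap_diag H)"
  proof (cases "C 0")
    case True
    have "\<beta> 0 = 1 \<or> \<beta> 0 = 2" using True b2[of 0] by (auto simp: C_def)
    then show ?thesis
      using True not_klein Z4 unfolding fsw delta_def n0 by auto
  next
    case False
    then show ?thesis
      using klein[OF _ False] unfolding fsw delta_def by auto
  qed
  have "of_nat (card H) \<noteq> (0 :: 'a)"
    using of_nat_neq_0_in_finite_field[of p e m] assms(1,3,4,6,8) by simp
  then have "2 * N_red m H = rho m pr \<beta> I r (GL2\<lparr>carrier := P 0\<rparr>) + delta \<beta> r (GL2\<lparr>carrier := P 0\<rparr>)"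
    using N_red_eq_swap_orbits[OF H] assms(6) unfolding rho delta by simp
  then have "2 * rat_of_nat (N_red m H) =
      rat_of_nat (rho m pr \<beta> I r (GL2\<lparr>carrier := P 0\<rparr>)) + rat_of_nat (delta \<beta> r (GL2\<lparr>carrier := P 0\<rparr>))"
    by (metis of_nat_add of_nat_mult of_nat_numeral)
  then show ?thesis by simp
qed

end
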